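(* For every odd prime $p$ there exists a finite group $G$ with Fitting length $2$ such that $m(G)=3$, $\mathrm{MaxDim}(G)=p$ and $i(G)=2p$.
   Context: For a finite group $G$, a finite sequence $(g_1,\dots,g_n)$ of elements of $G$ is irredundant if for every $k\in\{1,\dots,n\}$ the subgroup $\langle g_j \mid j\neq k\rangle$ is properly contained in $\langle g_1,\dots,g_n\rangle$. $i(G)$ denotes the maximum size of an irredundant sequence in $G$. $m(G)$ denotes the maximum size of an irredundant generating sequence of $G$, i.e. an irredundant sequence with $\langle g_1,\dots,g_n\rangle=G$. A family of subgroups $(H_k)_{k\in I}$ of $G$ is in general position if for every $k\in I$ the intersection $\bigcap_{j\neq k}H_j$ properly contains $\bigcap_{j\in I}H_j$ (the empty intersection is $G$). $\mathrm{MaxDim}(G)$ denotes the size of the largest family of maximal subgroups of $G$ in general position. The Fitting length of a finite soluble group $G$ is the least $n$ with $F_n(G)=G$, where $F_0(G)=1$ and $F_{k+1}(G)/F_k(G)$ is the Fitting subgroup (largest nilpotent normal subgroup) of $G/F_k(G)$; so Fitting length $2$ means that $G$ is not nilpotent but $G/F(G)$ is nilpotent, where $F(G)$ is the Fitting subgroup of $G$. *)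

theory Defs
  imports "HOL-Algebra.Algebra" "HOL-Computational_Algebra.Primes"
begin

definition irredundant_seq :: "('a, 'b) monoid_scheme \<Rightarrow> 'a list \<Rightarrow> bool" where
  "irredundant_seq G xs \<longleftrightarrow>
     set xs \<subseteq> carrier G \<and>
     (\<forall>k<length xs. generate G ((!) xs ` ({..<length xs} - {k})) \<subset> generate G (set xs))"

text \<open>For a finite group the sets below are finite and nonempty, so \<^const>\<open>Max\<close> is meaningful.\<close>

definition max_irredundant :: "('a, 'b) monoid_scheme \<Rightarrow> nat" where
  "max_irredundant G = Max {length xs | xs. irredundant_seq G xs}"

definition max_irredundant_generating :: "('a, 'b) monoid_scheme \<Rightarrow> nat" where
  "max_irredundant_generating G =
     Max {length xs | xs. irredundant_seq G xs \<and> generate G (set xs) = carrier G}"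

definition maximal_subgroup :: "'a set \<Rightarrow> ('a, 'b) monoid_scheme \<Rightarrow> bool" where
  "maximal_subgroup H G \<longleftrightarrow>
     subgroup H G \<and> H \<noteq> carrier G \<and>
     (\<forall>K. subgroup K G \<and> H \<subseteq> K \<longrightarrow> K = H \<or> K = carrier G)"

text \<open>Intersecting with \<^term>\<open>carrier G\<close> makes the empty intersection equal to the whole group.\<close>

definition general_position :: "('a, 'b) monoid_scheme \<Rightarrow> 'i set \<Rightarrow> ('i \<Rightarrow> 'a set) \<Rightarrow> bool" where
  "general_position G I H \<longleftrightarrow>
     (\<forall>k\<in>I. subgroup (H k) G) \<and>
     (\<forall>k\<in>I. carrier G \<inter> (\<Inter>j\<in>I. H j) \<subset> carrier G \<inter> (\<Inter>j\<in>I - {k}. H j))"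

definition MaxDim :: "('a, 'b) monoid_scheme \<Rightarrow> nat" where
  "MaxDim G =
     Max {n. \<exists>H :: nat \<Rightarrow> 'a set.
               (\<forall>k<n. maximal_subgroup (H k) G) \<and> general_position G {..<n} H}"

primrec lower_central_series :: "('a, 'b) monoid_scheme \<Rightarrow> nat \<Rightarrow> 'a set" where
  "lower_central_series G 0 = carrier G"
| "lower_central_series G (Suc n) =
     generate G (\<Union>x\<in>lower_central_series G n. \<Union>y\<in>carrier G.
                   {x \<otimes>\<^bsub>G\<^esub> y \<otimes>\<^bsub>G\<^esub> inv\<^bsub>G\<^esub> x \<otimes>\<^bsub>G\<^esub> inv\<^bsub>G\<^esub> y})"

definition nilpotent :: "('a, 'b) monoid_scheme \<Rightarrow> bool" where
  "nilpotent G \<longleftrightarrow> (\<exists>n. lower_central_series G n = {\<one>\<^bsub>G\<^esub>})"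

text \<open>The greatest element, with respect to inclusion, among the nilpotent normal subgroups;
  by Fitting's theorem it exists in every finite group.\<close>

definition fitting_subgroup :: "('a, 'b) monoid_scheme \<Rightarrow> 'a set" where
  "fitting_subgroup G = (GREATEST N. N \<lhd> G \<and> nilpotent (G\<lparr>carrier := N\<rparr>))"

text \<open>The successor step is the preimage in \<open>G\<close> of the Fitting subgroup of the quotient.\<close>

primrec fitting_series :: "('a, 'b) monoid_scheme \<Rightarrow> nat \<Rightarrow> 'a set" where
  "fitting_series G 0 = {\<one>\<^bsub>G\<^esub>}"
| "fitting_series G (Suc n) =
     {x \<in> carrier G. fitting_series G n #>\<^bsub>G\<^esub> x \<in> fitting_subgroup (G Mod fitting_series G n)}"

text \<open>Meaningful for finite soluble groups only: otherwise no such \<open>n\<close> need exist.\<close>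

definition fitting_length :: "('a, 'b) monoid_scheme \<Rightarrow> nat" where
  "fitting_length G = (LEAST n. fitting_series G n = carrier G)"

end

theory Submission
  imports Defs "HOL-Number_Theory.Pocklington"
begin

text \<open>Let \<open>q\<close> be a prime divisor of \<open>2 ^ p - 1\<close>, so that \<open>2\<close> has order \<open>p\<close> modulo \<open>q\<close>, and let
  \<open>G = V \<rtimes> H\<close> with \<open>V = \<int>\<^sub>q ^ p\<close> and \<open>H = \<int>\<^sub>p wr \<int>\<^sub>p\<close> acting by monomial matrices. The module \<open>V\<close> is
  faithful and irreducible, hence it is the Fitting subgroup, and a subgroup covering \<open>H\<close> either
  is \<open>G\<close> or meets \<open>V\<close> trivially. As \<open>H\<close> is a
  2-generator \<open>p\<close>-group, two of the members of a generating sequence generate \<open>G\<close> modulo \<open>V\<close>, so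
  together with at most one more they generate \<open>G\<close>.

  The order of \<open>G\<close> has \<open>2 p + 1\<close> prime factors, which bounds the length of a chain of subgroups;
  an irredundant sequence of length \<open>2 p + 1\<close> would generate \<open>G\<close>. The unit vectors together with the
  diagonal generators attain the length \<open>2 p\<close>.

  A maximal subgroup either contains \<open>V\<close>, and then comes from a line in the Frattini quotient of \<open>H\<close>, or is the stabilizer of
  a point of \<open>V\<close> under the affine action. If two of the points differ in two coordinates, the
  intersection of their stabilizers has order at most \<open>p ^ (p - 2)\<close>, and a chain of intersections gives
  the bound \<open>p\<close>; otherwise there are at most two points and three subgroups. The stabilizers of the unit
  vectors attain \<open>p\<close>.\<close>

section \<open>Irredundance and chains of subgroups\<close>

text \<open>Modulo \<open>VV\<close> the proof rests on one fact about the base group of H: as a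
  module over F_p[Z_p] = F_p[X]/(X-1)^p it is uniserial, its submodules being the multiples of the
  powers of X-1. The moments of an exponent vector detect this chain numerically. The chain enters
  twice. A vector whose moment 0 is nonzero generates the whole module, which is why the pair
  (\<open>S\<close>, \<open>C\<close>) decides whether a subgroup covers H. And the chain itself
  yields a central series, which makes H nilpotent. On V the argument is different: a single
  diagonal entry \<open>chi 1\<close> isolates one coordinate, and shifts spread it to the others.
  The base 2 is merely a way to reach a prime q that has a primitive p-th root of unity modulo q.
  That p is odd enters through p >= 3: the bound three for families of maximal subgroups without two
  points far apart must not exceed p, and p must not exceed p^(p-2).\<close>

abbreviation Omega :: "nat \<Rightarrow> nat" where
  "Omega n \<equiv> size (prime_factorization n)"

lemma Omega_prime_power:
  fixes r :: nat
  assumes "Factorial_Ring.prime r"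
  shows "Omega (r ^ n) = n"
  using assms by (simp add: prime_factorization_prime_power)

context group
begin

text \<open>An inverse is a power in a finite group. This spares computing the coordinates of
  inverses for every subgroup introduced below.\<close>

lemma finite_subgroupI:
  assumes "finite (carrier G)" "S \<subseteq> carrier G" "\<one> \<in> S"
    and "\<And>x y. x \<in> S \<Longrightarrow> y \<in> S \<Longrightarrow> x \<otimes> y \<in> S"
  shows "subgroup S G"
proof (rule subgroupI)
  show "S \<subseteq> carrier G" by fact
  show "S \<noteq> {}" using assms by auto
  fix x assume x: "x \<in> S"
  have pw: "x [^] (n::nat) \<in> S" for n
    by (induction n) (use assms x in auto)
  have xc: "x \<in> carrier G" using x assms by auto
  have o: "order G > 0" using assms(1) order_gt_0_iff_finite by blast
  have "x [^] (order G - 1) \<otimes> x = x [^] (order G)"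
    using o by (metis Suc_diff_1 nat_pow_Suc)
  also have "\<dots> = \<one>" using pow_order_eq_1 xc by blast
  finally have "inv x = x [^] (order G - 1)"
    using xc by (simp add: inv_equality)
  then show "inv x \<in> S" using pw by simp
  fix y assume "y \<in> S"
  then show "x \<otimes> y \<in> S" using assms x by auto
qed

lemma card_subgroup_dvd:
  assumes "subgroup A G" "subgroup B G" "A \<subseteq> B"
  shows "card A dvd card B"
proof -
  interpret B: group "G\<lparr>carrier := B\<rparr>" using assms subgroup.subgroup_is_group by blast
  have "subgroup A (G\<lparr>carrier := B\<rparr>)"
    using assms subgroup_incl by blast
  then show ?thesis
    using B.lagrange[of A] by (simp add: order_def) (metis dvd_triv_right)
qed

lemma Omega_subgroup_psubset:
  assumes "finite (carrier G)" "subgroup A G" "subgroup B G" "A \<subset> B"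
  shows "Omega (card A) < Omega (card B)"
proof -
  obtain m where m: "card B = card A * m"
    using card_subgroup_dvd[of A B] assms by (auto elim: dvdE)
  have fin: "finite B" using assms(1,3) subgroup.subset finite_subset by blast
  have "card A < card B" using fin assms(4) by (rule psubset_card_mono)
  moreover have "card A > 0" using assms(1,2) subgroup.finite_imp_card_positive by blast
  ultimately have m1: "m > 1"
    using m mult_less_cancel1[of "card A" 1 m] by simp
  then have "prime_factorization m \<noteq> {#}"
    by (auto simp: prime_factorization_empty_iff)
  then have "0 < Omega m"
    by (simp add: nonempty_has_size)
  then show ?thesis
    using m m1 \<open>card A > 0\<close> by (simp add: prime_factorization_mult)
qed

text \<open>The prefixes generate a strictly ascending chain, since each entry lies outside the
  subgroup generated by all the others. Each strict inclusion adds at least one prime factor to the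
  order.\<close>

lemma irredundant_seq_length_le:
  assumes fin: "finite (carrier G)" and irr: "irredundant_seq G xs"
  shows "length xs \<le> Omega (card (generate G (set xs)))"
proof -
  have sub: "set xs \<subseteq> carrier G" using irr by (simp add: irredundant_seq_def)
  have "k \<le> length xs \<Longrightarrow> k \<le> Omega (card (generate G (set (take k xs))))" for k
  proof (induction k)
    case (Suc k)
    let ?A = "generate G (set (take k xs))" and ?B = "generate G (set (take (Suc k) xs))"
    have k: "k < length xs" using Suc by simp
    have subA: "set (take k xs) \<subseteq> carrier G" and subB: "set (take (Suc k) xs) \<subseteq> carrier G"
      using sub by (meson order_trans set_take_subset)+
    have AB: "?A \<subseteq> ?B" by (intro mono_generate set_take_subset_set_take) simp
    have in_B: "xs ! k \<in> ?B" using k by (intro generate.incl) (simp add: take_Suc_conv_app_nth)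
    let ?R = "generate G ((!) xs ` ({..<length xs} - {k}))"
    have subR: "(!) xs ` ({..<length xs} - {k}) \<subseteq> carrier G"
      using sub nth_mem by blast
    have R: "?R \<subset> generate G (set xs)"
      using irr k by (simp add: irredundant_seq_def)
    have "set (take k xs) \<subseteq> (!) xs ` ({..<length xs} - {k})"
      using k by (auto simp: in_set_conv_nth)
    then have AR: "?A \<subseteq> ?R" by (rule mono_generate)
    have "xs ! k \<notin> ?A"
    proof
      assume "xs ! k \<in> ?A"
      with AR have kR: "xs ! k \<in> ?R" by blast
      have "set xs \<subseteq> ?R"
      proof
        fix x assume "x \<in> set xs"
        then obtain i where i: "i < length xs" "x = xs ! i" by (auto simp: in_set_conv_nth)
        show "x \<in> ?R"
          using i kR by (cases "i = k") (auto intro!: generate.incl)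
      qed
      then have "generate G (set xs) \<subseteq> ?R"
        using generate_subgroup_incl generate_is_subgroup subR by blast
      with R show False by blast
    qed
    with AB in_B have "?A \<subset> ?B" by blast
    then have "Omega (card ?A) < Omega (card ?B)"
      using Omega_subgroup_psubset fin generate_is_subgroup subA subB by blast
    then show ?case using Suc by simp
  qed simp
  from this[of "length xs"] show ?thesis by simp
qed

lemma irredundant_seqI:
  assumes "set xs \<subseteq> carrier G"
    and "\<And>k. k < length xs \<Longrightarrow> \<exists>K. subgroup K G \<and> xs ! k \<notin> K \<and>
           (\<forall>j<length xs. j \<noteq> k \<longrightarrow> xs ! j \<in> K)"
  shows "irredundant_seq G xs"
  unfolding irredundant_seq_def
proof (intro conjI allI impI)
  fix k assume k: "k < length xs"
  then obtain K where K: "subgroup K G" "xs ! k \<notin> K"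
      "\<forall>j<length xs. j \<noteq> k \<longrightarrow> xs ! j \<in> K"
    using assms(2) by blast
  have "generate G ((!) xs ` ({..<length xs} - {k})) \<subseteq> K"
    using K by (intro generate_subgroup_incl) auto
  moreover have "xs ! k \<in> generate G (set xs)" using k by (auto intro: generate.incl)
  moreover have "generate G ((!) xs ` ({..<length xs} - {k})) \<subseteq> generate G (set xs)"
    by (rule mono_generate) auto
  ultimately show "generate G ((!) xs ` ({..<length xs} - {k})) \<subset> generate G (set xs)"
    using K(2) by blast
qed (fact assms)

end

lemma general_position_witness:
  assumes "general_position G I H" "k \<in> I"
  obtains g where "g \<in> carrier G" "g \<notin> H k" "\<And>j. j \<in> I \<Longrightarrow> j \<noteq> k \<Longrightarrow> g \<in> H j"
proof -
  have "carrier G \<inter> (\<Inter>j\<in>I. H j) \<subset> carrier G \<inter> (\<Inter>j\<in>I - {k}. H j)"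
    using assms by (simp add: general_position_def)
  then obtain g where "g \<in> carrier G" "\<forall>j\<in>I-{k}. g \<in> H j" "\<not> (\<forall>j\<in>I. g \<in> H j)"
    by auto
  then show ?thesis using that[of g] by (metis DiffI singletonD)
qed

lemma general_positionI:
  assumes "\<And>k. k \<in> I \<Longrightarrow> subgroup (H k) G"
    and "\<And>k. k \<in> I \<Longrightarrow> \<exists>g\<in>carrier G. g \<notin> H k \<and> (\<forall>j\<in>I. j \<noteq> k \<longrightarrow> g \<in> H j)"
  shows "general_position G I H"
  unfolding general_position_def
proof (intro conjI ballI)
  fix k assume k: "k \<in> I"
  obtain g where "g \<in> carrier G" "g \<notin> H k" "\<forall>j\<in>I. j \<noteq> k \<longrightarrow> g \<in> H j"
    using assms(2)[OF k] by blast
  then show "carrier G \<inter> (\<Inter>j\<in>I. H j) \<subset> carrier G \<inter> (\<Inter>j\<in>I - {k}. H j)"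
    using k by auto
qed (fact assms)

text \<open>Dual to the bound for irredundant sequences: adding the indices of \<open>I - A\<close>
  one at a time shrinks the intersection strictly, as the witness for an index lies in all other
  members. The freedom in \<open>A\<close> allows the chain to start at a small intersection of two
  chosen members.\<close>

lemma (in group) general_position_card_le:
  assumes fin: "finite (carrier G)" and gp: "general_position G I H"
    and "finite I" "A \<subseteq> I"
  shows "card (I - A) \<le> Omega (card (carrier G \<inter> (\<Inter>j\<in>A. H j)))"
  using assms(4)
proof (induction "card (I - A)" arbitrary: A)
  case (Suc m)
  have subgr: "subgroup (carrier G \<inter> (\<Inter>j\<in>B. H j)) G" if "B \<subseteq> I" for B
  proof (rule finite_subgroupI[OF fin])
    have *: "\<And>j. j \<in> B \<Longrightarrow> subgroup (H j) G" using gp that by (auto simp: general_position_def)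
    show "\<one> \<in> carrier G \<inter> (\<Inter>j\<in>B. H j)" using * subgroup.one_closed by auto
    fix x y assume "x \<in> carrier G \<inter> (\<Inter>j\<in>B. H j)" "y \<in> carrier G \<inter> (\<Inter>j\<in>B. H j)"
    then show "x \<otimes> y \<in> carrier G \<inter> (\<Inter>j\<in>B. H j)"
      using subgroup.m_closed[OF *] by auto
  qed auto
  from Suc(2) obtain k where k: "k \<in> I" "k \<notin> A"
    by (metis Diff_eq_empty_iff card.empty nat.distinct(1) subsetI)
  have "card (I - insert k A) = m"
    using Suc(2) k \<open>finite I\<close> by (metis Diff_insert DiffI card_Diff_singleton diff_Suc_1)
  with Suc(1)[of "insert k A"] k Suc(3)
  have IH: "m \<le> Omega (card (carrier G \<inter> (\<Inter>j\<in>insert k A. H j)))" by auto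
  obtain g where g: "g \<in> carrier G" "g \<notin> H k" "\<And>j. j \<in> I \<Longrightarrow> j \<noteq> k \<Longrightarrow> g \<in> H j"
    using general_position_witness[OF gp k(1)] by blast
  then have "carrier G \<inter> (\<Inter>j\<in>insert k A. H j) \<subset> carrier G \<inter> (\<Inter>j\<in>A. H j)"
    using Suc(3) k by (auto; blast)
  then have "Omega (card (carrier G \<inter> (\<Inter>j\<in>insert k A. H j))) < Omega (card (carrier G \<inter> (\<Inter>j\<in>A. H j)))"
    using Omega_subgroup_psubset[OF fin] subgr Suc(3) k(1) by (metis insert_subset)
  with IH Suc(2) show ?case by simp
qed simp

lemma card_ge_3E:
  assumes "card B \<ge> 3"
  obtains a b c where "a \<in> B" "b \<in> B" "c \<in> B" "a \<noteq> b" "a \<noteq> c" "b \<noteq> c"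
proof -
  obtain Y where "Y \<subseteq> B" "card Y = 3" using assms obtain_subset_with_card_n by metis
  then show ?thesis using that unfolding card_3_iff by blast
qed

lemma card_ge_2E:
  assumes "card B \<ge> 2"
  obtains a b where "a \<in> B" "b \<in> B" "a \<noteq> b"
proof -
  obtain Y where "Y \<subseteq> B" "card Y = 2" using assms obtain_subset_with_card_n by metis
  then show ?thesis using that unfolding card_2_iff by blast
qed

section \<open>Nilpotent and derived subgroups\<close>

text \<open>The lower central series descends fastest among all central series, so any explicit one
  bounds it.\<close>

lemma (in group) lower_central_series_subset:
  assumes "\<And>n. subgroup (\<Gamma> n) G" "\<Gamma> 0 = carrier G"
    and "\<And>n x y. x \<in> \<Gamma> n \<Longrightarrow> y \<in> carrier G \<Longrightarrow> x \<otimes> y \<otimes> inv x \<otimes> inv y \<in> \<Gamma> (Suc n)"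
  shows "lower_central_series G n \<subseteq> \<Gamma> n"
proof (induction n)
  case (Suc n)
  then have "(\<Union>x\<in>lower_central_series G n. \<Union>y\<in>carrier G. {x \<otimes> y \<otimes> inv x \<otimes> inv y}) \<subseteq> \<Gamma> (Suc n)"
    using assms(3) by auto
  then show ?case using assms(1) by (auto dest: generate_subgroup_incl)
qed (use assms in simp)

lemma (in group) one_in_lower_central_series: "\<one> \<in> lower_central_series G n"
  by (cases n) (auto intro: generate.one)

lemma (in group) nilpotentI:
  assumes "\<And>n. subgroup (\<Gamma> n) G" "\<Gamma> 0 = carrier G"
    and "\<And>n x y. x \<in> \<Gamma> n \<Longrightarrow> y \<in> carrier G \<Longrightarrow> x \<otimes> y \<otimes> inv x \<otimes> inv y \<in> \<Gamma> (Suc n)"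
    and "\<Gamma> m = {\<one>}"
  shows "nilpotent G"
  using lower_central_series_subset[of \<Gamma> m] one_in_lower_central_series[of m] assms
  unfolding nilpotent_def by blast

lemma (in comm_group) comm_group_nilpotent: "nilpotent G"
proof -
  have "x \<otimes> y \<otimes> inv x \<otimes> inv y = \<one>" if "x \<in> carrier G" "y \<in> carrier G" for x y
    using that by (simp add: m_comm[of x y] m_assoc)
  moreover have "generate G {\<one>} = {\<one>}"
    using generate_subgroup_incl[OF _ triv_subgroup, of "{\<one>}"] generate.one by blast
  ultimately have "lower_central_series G (Suc 0) = {\<one>}"
    by (auto simp: cong: SUP_cong)
  then show ?thesis unfolding nilpotent_def by blast
qed

lemma fitting_subgroupI:
  assumes "N \<lhd> G" "nilpotent (G\<lparr>carrier := N\<rparr>)"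
    and "\<And>M. M \<lhd> G \<Longrightarrow> nilpotent (G\<lparr>carrier := M\<rparr>) \<Longrightarrow> M \<subseteq> N"
  shows "fitting_subgroup G = N"
  unfolding fitting_subgroup_def using assms by (intro Greatest_equality) auto

lemma (in group) fitting_subgroup_nilpotent:
  assumes "nilpotent G"
  shows "fitting_subgroup G = carrier G"
proof (rule fitting_subgroupI)
  show "carrier G \<lhd> G"
    by (intro normal_invI subgroup_self) auto
  show "M \<subseteq> carrier G" if "M \<lhd> G" for M
    using that normal_imp_subgroup subgroup.subset by blast
qed (use assms in simp)

lemma (in group) derived_subset:
  assumes "subgroup K G" "\<And>x y. x \<in> H \<Longrightarrow> y \<in> H \<Longrightarrow> x \<otimes> y \<otimes> inv x \<otimes> inv y \<in> K"
  shows "derived G H \<subseteq> K"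
  unfolding derived_def using assms by (intro generate_subgroup_incl) auto

section \<open>Periodic functions and moments\<close>

lemma not_dvd_small: "0 \<le> (x::int) \<Longrightarrow> x < int n \<Longrightarrow> x \<noteq> 0 \<Longrightarrow> \<not> int n dvd x"
  using zdvd_not_zless[of x "int n"] by simp

text \<open>Encoding functions on Z/p on all integers turns a cyclic shift into a plain subtraction
  in the argument.\<close>

definition periodic :: "nat \<Rightarrow> (int \<Rightarrow> int) \<Rightarrow> bool" where
  "periodic p f \<longleftrightarrow> (\<forall>i. f (i + int p) = f i)"

lemma periodic_add_mult:
  assumes "periodic p f"
  shows "f (i + int p * k) = f i"
proof (induction k rule: int_induct[where k=0])
  case (step1 k)
  have "f (i + int p * (k + 1)) = f (i + int p * k + int p)" by (simp add: algebra_simps)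
  then show ?case using assms step1 by (simp add: periodic_def)
next
  case (step2 k)
  have "f (i + int p * (k - 1)) = f (i + int p * (k - 1) + int p)"
    using assms by (simp add: periodic_def)
  also have "\<dots> = f (i + int p * k)" by (simp add: algebra_simps)
  finally show ?case using step2 by simp
qed simp

lemma periodic_mod: "periodic p f \<Longrightarrow> f (i mod int p) = f i"
  using periodic_add_mult[of p f "i mod int p" "i div int p"] by simp

lemma periodic_shift: "periodic p f \<Longrightarrow> periodic p (\<lambda>i. f (i - c))"
  unfolding periodic_def by (metis add_diff_eq diff_add_eq)

lemma periodic_eqI:
  assumes "periodic p f" "periodic p g" "p > 0" "\<And>i. 0 \<le> i \<Longrightarrow> i < int p \<Longrightarrow> f i = g i"
  shows "f = g"
proof
  fix i show "f i = g i"
    using assms(4)[of "i mod int p"] periodic_mod[OF assms(1), of i] periodic_mod[OF assms(2), of i] assms(3)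
    by simp
qed

lemma card_reduced_periodic:
  assumes "p > 0"
  shows "card {f. periodic p f \<and> (\<forall>i. 0 \<le> f i \<and> f i < int n)} = n ^ p"
    and "finite {f. periodic p f \<and> (\<forall>i. 0 \<le> f i \<and> f i < int n)}"
proof -
  let ?R = "{f. periodic p f \<and> (\<forall>i. 0 \<le> f i \<and> f i < int n)}"
  let ?P = "PiE {0..<int p} (\<lambda>_. {0..<int n})"
  have bij: "bij_betw (\<lambda>f. restrict f {0..<int p}) ?R ?P"
    unfolding bij_betw_def
  proof
    show "inj_on (\<lambda>f. restrict f {0..<int p}) ?R"
    proof (rule inj_onI)
      fix f g assume fg: "f \<in> ?R" "g \<in> ?R" "restrict f {0..<int p} = restrict g {0..<int p}"
      show "f = g"
      proof (rule periodic_eqI)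
        fix i assume "0 \<le> i" "i < int p"
        then show "f i = g i" using fun_cong[OF fg(3), of i] by simp
      qed (use fg assms in auto)
    qed
    show "(\<lambda>f. restrict f {0..<int p}) ` ?R = ?P"
    proof (intro equalityI subsetI)
      fix g assume g: "g \<in> ?P"
      let ?f = "\<lambda>i. g (i mod int p)"
      have "0 \<le> ?f i \<and> ?f i < int n" for i
        using PiE_mem[OF g, of "i mod int p"] assms by simp
      then have "?f \<in> ?R" by (simp add: periodic_def)
      moreover have "g = restrict ?f {0..<int p}"
        using g by (auto simp: restrict_def PiE_def extensional_def)
      ultimately show "g \<in> (\<lambda>f. restrict f {0..<int p}) ` ?R"
        by (intro image_eqI[where x="?f"])
    qed auto
  qed
  have "card ?P = n ^ p" by (simp add: card_PiE)
  then show "card ?R = n ^ p" using bij_betw_same_card[OF bij] by simp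
  have "finite ?P" by (intro finite_PiE) auto
  then show "finite ?R" using bij_betw_finite[OF bij] by simp
qed

lemma sum_periodic_shift:
  assumes "periodic p f" "p > 0"
  shows "(\<Sum>i=0..<int p. f (i + c)) = (\<Sum>i=0..<int p. f i)"
proof (rule sum.reindex_bij_witness[where i="\<lambda>i. (i - c) mod int p" and j="\<lambda>i. (i + c) mod int p"])
  fix a assume a: "a \<in> {0..<int p}"
  then show "((a + c) mod int p - c) mod int p = a" "((a - c) mod int p + c) mod int p = a"
    by (simp_all add: mod_simps)
  show "(a + c) mod int p \<in> {0..<int p}" "(a - c) mod int p \<in> {0..<int p}"
    using assms(2) by auto
  show "f ((a + c) mod int p) = f (a + c)" using assms(1) by (rule periodic_mod)
qed

text \<open>For j < p these are, modulo p and up to triangular recombination with invertible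
  diagonal, the Taylor coefficients at X = 1 of the polynomial with coefficients \<open>a i\<close>.
  So the vanishing of the first k <= p moments means divisibility by (X-1)^k.\<close>

definition moment :: "nat \<Rightarrow> nat \<Rightarrow> (int \<Rightarrow> int) \<Rightarrow> int" where
  "moment p j a = (\<Sum>i=0..<int p. i ^ j * a i)"

lemma moment_cong:
  assumes "\<And>i. [a i = b i] (mod int p)"
  shows "[moment p j a = moment p j b] (mod int p)"
  unfolding moment_def by (intro cong_sum cong_mult assms cong_refl)

lemma moment_mod: "[moment p j (\<lambda>i. a i mod int p) = moment p j a] (mod int p)"
  by (rule moment_cong) (simp add: cong_def)

lemma moment_add: "moment p j (\<lambda>i. a i + b i) = moment p j a + moment p j b"
  by (simp add: moment_def distrib_left sum.distrib)

lemma moment_diff: "moment p j (\<lambda>i. a i - b i) = moment p j a - moment p j b"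
  by (simp add: moment_def right_diff_distrib sum_subtractf)

lemma moment_scale: "moment p j (\<lambda>i. c * a i) = c * moment p j a"
  by (simp add: moment_def sum_distrib_left mult.left_commute)

lemma moment_shift:
  assumes a: "periodic p a" and "p > 0"
  shows "[moment p j (\<lambda>i. a (i - c)) =
          (\<Sum>l\<le>j. int (j choose l) * c ^ (j - l) * moment p l a)] (mod int p)"
proof -
  \<comment> \<open>The power \<open>i ^ j\<close> is periodic only modulo p, so the summand is
    reduced before the sum is shifted.\<close>
  let ?f = "\<lambda>i. (i ^ j * a (i - c)) mod int p"
  have f: "periodic p ?f"
    unfolding periodic_def
  proof
    fix i
    have "a (i + int p - c) = a (i - c)" using a by (metis add_diff_eq diff_add_eq periodic_def)
    moreover have "[(i + int p) ^ j = i ^ j] (mod int p)"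
      by (intro cong_pow) (simp add: cong_def)
    ultimately show "?f (i + int p) = ?f i"
      by (metis cong_def cong_scalar_right)
  qed
  have "[moment p j (\<lambda>i. a (i - c)) = (\<Sum>i=0..<int p. ?f i)] (mod int p)"
    unfolding moment_def by (intro cong_sum) (simp add: cong_def)
  also have "(\<Sum>i=0..<int p. ?f i) = (\<Sum>i=0..<int p. ?f (i + c))"
    by (rule sum_periodic_shift[OF f \<open>p > 0\<close>, symmetric])
  also have "[\<dots> = (\<Sum>i=0..<int p. (i + c) ^ j * a i)] (mod int p)"
    by (intro cong_sum) (simp add: cong_def)
  also have "(\<Sum>i=0..<int p. (i + c) ^ j * a i) =
      (\<Sum>i=0..<int p. \<Sum>l\<le>j. int (j choose l) * c ^ (j - l) * (i ^ l * a i))"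
    by (simp add: binomial_ring sum_distrib_right sum_distrib_left mult_ac)
  also have "\<dots> = (\<Sum>l\<le>j. int (j choose l) * c ^ (j - l) * moment p l a)"
    unfolding moment_def sum_distrib_left by (rule sum.swap)
  finally show ?thesis .
qed

lemma moment_shift_dvd:
  assumes a: "periodic p a" and "p > 0" and "\<And>l. l \<le> j \<Longrightarrow> int p dvd moment p l a"
  shows "int p dvd moment p j (\<lambda>i. a (i - c))"
proof -
  have "int p dvd (\<Sum>l\<le>j. int (j choose l) * c ^ (j - l) * moment p l a)"
    using assms(3) by (intro dvd_sum) auto
  then show ?thesis using moment_shift[OF a \<open>p > 0\<close>, of j c] by (metis cong_dvd_iff)
qed

text \<open>Modulo \<open>p\<close>, passing from \<open>a\<close> to its difference with a shift kills the lowest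
  nonvanishing moment and multiplies it, up to a factor, into the next one.\<close>

lemma moment_shift_lowest:
  assumes a: "periodic p a" and "p > 0" and "\<And>l. l < k \<Longrightarrow> int p dvd moment p l a"
  shows "[moment p k (\<lambda>i. a (i - c)) = moment p k a] (mod int p)"
    and "[moment p (Suc k) (\<lambda>i. a (i - c)) =
          moment p (Suc k) a + int (Suc k) * c * moment p k a] (mod int p)"
proof -
  let ?t = "\<lambda>j l. int (j choose l) * c ^ (j - l) * moment p l a"
  have z: "[(\<Sum>l<k. ?t j l) = 0] (mod int p)" for j
    unfolding cong_0_iff using assms(3) by (intro dvd_sum) auto
  have "(\<Sum>l\<le>k. ?t k l) = (\<Sum>l<k. ?t k l) + moment p k a"
    by (simp add: lessThan_Suc_atMost[symmetric])
  then show "[moment p k (\<lambda>i. a (i - c)) = moment p k a] (mod int p)"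
    using cong_trans[OF moment_shift[OF a \<open>p > 0\<close>, of k c]]
      cong_add[OF z[of k] cong_refl, of "moment p k a"] by (simp only: add_0)
  have "(\<Sum>l\<le>Suc k. ?t (Suc k) l) =
      (\<Sum>l<k. ?t (Suc k) l) + (moment p (Suc k) a + int (Suc k) * c * moment p k a)"
    by (simp add: lessThan_Suc_atMost[symmetric])
  then show "[moment p (Suc k) (\<lambda>i. a (i - c)) =
          moment p (Suc k) a + int (Suc k) * c * moment p k a] (mod int p)"
    using cong_trans[OF moment_shift[OF a \<open>p > 0\<close>, of "Suc k" c]]
      cong_add[OF z[of "Suc k"] cong_refl, of "moment p (Suc k) a + int (Suc k) * c * moment p k a"]
    by (simp only: add_0)
qed

text \<open>By Fermat, \<open>1 - i ^ (p - 1)\<close> is the indicator of \<open>i = 0\<close> modulo \<open>p\<close>, so the moments of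
  the shifts of \<open>a\<close> recover the values of \<open>a\<close>.\<close>

lemma moments_zero_imp:
  assumes a: "periodic p a" and p: "Factorial_Ring.prime p"
    and m: "\<And>l. l < p \<Longrightarrow> int p dvd moment p l a"
  shows "int p dvd a i"
proof -
  have p0: "p > 0" using p prime_gt_0_nat by blast
  let ?b = "\<lambda>k. a (k - (- i))"
  have b: "int p dvd moment p l ?b" if "l < p" for l
    using moment_shift_dvd[OF a p0, of l "- i"] m that by auto
  have "moment p 0 ?b - moment p (p - 1) ?b = (\<Sum>k=0..<int p. (1 - k ^ (p - 1)) * ?b k)"
    by (simp add: moment_def algebra_simps sum_subtractf)
  also have "\<dots> = (1 - 0 ^ (p - 1)) * ?b 0 + (\<Sum>k\<in>{0..<int p} - {0}. (1 - k ^ (p - 1)) * ?b k)"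
    using p0 by (intro sum.remove) auto
  also have "(1 - 0 ^ (p - 1)) * ?b 0 = a i"
    using prime_gt_1_nat[OF p] by simp
  finally have "a i = moment p 0 ?b - moment p (p - 1) ?b -
     (\<Sum>k\<in>{0..<int p} - {0}. (1 - k ^ (p - 1)) * ?b k)" by simp
  moreover have "int p dvd (1 - k ^ (p - 1)) * ?b k" if "k \<in> {0..<int p} - {0}" for k
  proof -
    have k: "k = int (nat k)" "0 < nat k" "nat k < p" using that by auto
    then have "\<not> p dvd nat k" using nat_dvd_not_less by blast
    then have "[nat k ^ (p - 1) = 1] (mod p)" using fermat_theorem p by blast
    then have "[int (nat k) ^ (p - 1) = 1] (mod int p)" by (metis cong_int_iff of_nat_1 of_nat_power)
    then have "int p dvd 1 - k ^ (p - 1)"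
      using k(1) by (metis cong_iff_dvd_diff cong_sym)
    then show ?thesis by simp
  qed
  then have "int p dvd (\<Sum>k\<in>{0..<int p} - {0}. (1 - k ^ (p - 1)) * ?b k)"
    by (rule dvd_sum)
  ultimately show ?thesis
    using b[of 0] b[of "p - 1"] p0 by (simp only:) (intro dvd_diff, auto)
qed

text \<open>The coefficient is a natural number so that it can serve as an exponent in the group or
  as a number of repetitions.\<close>

lemma prime_modulus_coefficient:
  fixes r :: nat and x y :: int
  assumes "Factorial_Ring.prime r" "\<not> int r dvd x"
  obtains n :: nat where "[int n * x = y] (mod int r)"
proof -
  have r: "Factorial_Ring.prime (int r)" using assms by simp
  then have "coprime x (int r)"
    using assms(2) by (metis coprime_commute prime_imp_coprime)
  then obtain z where "[x * z = 1] (mod int r)" using cong_solve_coprime_int by blast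
  then have "[x * z * y = 1 * y] (mod int r)" by (rule cong_scalar_right)
  then have "[z * y * x = y] (mod int r)" by (simp add: mult_ac)
  moreover have "[int (nat ((z * y) mod int r)) = z * y] (mod int r)"
    using assms(1) prime_gt_0_nat[of r] by (simp add: cong_def)
  ultimately have "[int (nat ((z * y) mod int r)) * x = y] (mod int r)"
    by (meson cong_scalar_right cong_trans)
  then show ?thesis using that by blast
qed

text \<open>\<open>D\<close> is a submodule of the group algebra of Z/p over F_p. That algebra is
  local with the augmentation ideal as maximal ideal, so \<open>b\<close>, whose coefficients have
  nonzero sum, is a unit and generates everything. Concretely, applying "shift minus identity"
  repeatedly to \<open>b\<close> yields for every k < p an element of \<open>D\<close> whose first
  nonzero moment is the k-th, and these clear the moments of \<open>f\<close> by
  elimination.\<close>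

lemma shift_invariant_full:
  fixes D :: "(int \<Rightarrow> int) \<Rightarrow> bool"
  assumes p: "Factorial_Ring.prime p"
    and per: "\<And>f. D f \<Longrightarrow> periodic p f"
    and add: "\<And>f g. D f \<Longrightarrow> D g \<Longrightarrow> D (\<lambda>i. (f i + g i) mod int p)"
    and shift: "\<And>f. D f \<Longrightarrow> D (\<lambda>i. f (i - 1))"
    and b: "D b" "\<not> int p dvd moment p 0 b"
    and f: "periodic p f" "\<And>i. 0 \<le> f i \<and> f i < int p"
  shows "D f"
proof -
  have p0: "p > 0" using p prime_gt_0_nat by blast
  \<comment> \<open>Closure under sums gives only multiples with at least two summands, and
    \<open>g\<close> need not be reduced. Hence \<open>g\<close> modulo p is reached as the
    (p+1)-fold sum, and in \<open>scale\<close> the zero multiple as the p-fold one.\<close>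
  have scale1: "D (\<lambda>i. (int (Suc n) * g i) mod int p)" if g: "D g" for g n
  proof (induction n)
    case 0
    have "D (\<lambda>i. (int (Suc (Suc n)) * g i) mod int p)" for n
    proof (induction n)
      case 0 show ?case using add[OF g g] by (simp add: mod_simps)
    next
      case (Suc n)
      from add[OF this g] show ?case by (simp add: mod_simps algebra_simps)
    qed
    from this[of "p - 1"] show ?case using p0 by (simp add: algebra_simps)
  next
    case (Suc n)
    from add[OF this g] show ?case by (simp add: mod_simps algebra_simps)
  qed
  have scale: "D (\<lambda>i. (int n * g i) mod int p)" if g: "D g" for g n
  proof -
    have "int (Suc (n + p - 1)) * g i mod int p = int n * g i mod int p" for i
      using p0 by (simp add: algebra_simps)
    then show ?thesis using scale1[OF g, of "n + p - 1"] by simp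
  qed
  have low: "\<exists>b. D b \<and> (\<forall>l<k. int p dvd moment p l b) \<and> \<not> int p dvd moment p k b"
    if "k < p" for k
    using that
  proof (induction k)
    case 0 then show ?case using b by auto
  next
    case (Suc k)
    then obtain b where b: "D b" "\<And>l. l < k \<Longrightarrow> int p dvd moment p l b" "\<not> int p dvd moment p k b"
      by auto
    \<comment> \<open>The coefficient p - 1 stands for -1, as \<open>D\<close> is closed under sums
      only.\<close>
    let ?d = "\<lambda>i. b (i - 1) + int (p - 1) * b i"
    have D: "D (\<lambda>i. ?d i mod int p)"
      using add[OF shift[OF b(1)] scale[OF b(1), of "p - 1"]] by (simp add: mod_simps)
    have m: "[moment p l (\<lambda>i. ?d i mod int p) = moment p l (\<lambda>i. b (i - 1)) - moment p l b] (mod int p)" for l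
    proof -
      have "[moment p l (\<lambda>i. ?d i mod int p) = moment p l ?d] (mod int p)" by (rule moment_mod)
      also have "moment p l ?d = moment p l (\<lambda>i. b (i - 1)) + int (p - 1) * moment p l b"
        by (simp add: moment_add moment_scale)
      also have "[\<dots> = moment p l (\<lambda>i. b (i - 1)) - moment p l b] (mod int p)"
        using p0 by (simp add: cong_iff_dvd_diff of_nat_diff algebra_simps)
      finally show ?thesis .
    qed
    have pb: "periodic p b" using per b by blast
    have "int p dvd moment p l (\<lambda>i. ?d i mod int p)" if "l < Suc k" for l
    proof (cases "l = k")
      case True
      have "int p dvd moment p l (\<lambda>i. b (i - 1)) - moment p l b"
        using moment_shift_lowest(1)[OF pb p0 b(2), of k 1] True by (simp add: cong_iff_dvd_diff)
      then show ?thesis using m[of l] cong_dvd_iff by blast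
    next
      case False
      then have "l < k" using that by simp
      then have "int p dvd moment p l (\<lambda>i. b (i - 1)) - moment p l b"
        using moment_shift_dvd[OF pb p0, of l 1] b(2) by auto
      then show ?thesis using m[of l] cong_dvd_iff by blast
    qed
    moreover have "\<not> int p dvd moment p (Suc k) (\<lambda>i. ?d i mod int p)"
    proof
      assume "int p dvd moment p (Suc k) (\<lambda>i. ?d i mod int p)"
      then have 1: "int p dvd moment p (Suc k) (\<lambda>i. b (i - 1)) - moment p (Suc k) b"
        using m[of "Suc k"] cong_dvd_iff by blast
      have "[moment p (Suc k) (\<lambda>i. b (i - 1)) - moment p (Suc k) b = int (Suc k) * moment p k b] (mod int p)"
        using moment_shift_lowest(2)[OF pb p0 b(2), of k 1]
        by (simp add: cong_iff_dvd_diff algebra_simps)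
      with 1 have "int p dvd int (Suc k) * moment p k b" using cong_dvd_iff by blast
      then have "int p dvd int (Suc k)" using p b(3) prime_dvd_mult_iff[of "int p"] by auto
      then show False using Suc.prems by (metis int_dvd_int_iff nat_dvd_not_less zero_less_Suc)
    qed
    ultimately show ?case using D by blast
  qed
  \<comment> \<open>Elimination: \<open>m\<close> counts the top moments of \<open>f\<close> that
    may still be nonzero. For \<open>m = 0\<close> all moments vanish, so \<open>f\<close> is
    zero.\<close>
  have "m \<le> p \<Longrightarrow> periodic p f \<Longrightarrow> (\<And>i. 0 \<le> f i \<and> f i < int p) \<Longrightarrow>
     (\<And>l. l < p - m \<Longrightarrow> int p dvd moment p l f) \<Longrightarrow> D f" for m f
  proof (induction m arbitrary: f)
    case 0
    then have "int p dvd f i" for i using moments_zero_imp[OF _ p, of f i] by auto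
    then have "f i = 0" for i using "0.prems"(3)[of i] by (metis zdvd_not_zless less_le)
    then have "f = (\<lambda>i. (int 0 * b i) mod int p)" by auto
    then show ?case using scale[OF b(1), of 0] by simp
  next
    case (Suc m)
    let ?k = "p - Suc m"
    obtain b where b: "D b" "\<And>l. l < ?k \<Longrightarrow> int p dvd moment p l b" "\<not> int p dvd moment p ?k b"
      using low[of ?k] p0 by auto
    obtain c where c: "[int c * moment p ?k b = moment p ?k f] (mod int p)"
      using prime_modulus_coefficient[OF p b(3)] .
    let ?g = "\<lambda>i. (f i - int c * b i) mod int p"
    have pb: "periodic p b" using per b by blast
    have mg: "[moment p l ?g = moment p l f - int c * moment p l b] (mod int p)" for l
      using moment_mod[of p l "\<lambda>i. f i - int c * b i"] by (simp add: moment_diff moment_scale)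
    have g: "D ?g"
    proof (rule Suc.IH)
      show "periodic p ?g" using pb Suc.prems(2) by (auto simp: periodic_def)
      fix l assume "l < p - m"
      then consider "l = ?k" | "l < ?k" using Suc.prems(1) by linarith
      then have "int p dvd moment p l f - int c * moment p l b"
      proof cases
        case 1
        then show ?thesis using c by (simp add: cong_iff_dvd_diff dvd_diff_commute)
      next
        case 2
        then show ?thesis using b(2) Suc.prems(4) by auto
      qed
      then show "int p dvd moment p l ?g" using mg[of l] cong_dvd_iff by blast
    qed (use p0 Suc.prems in auto)
    have "(?g i + (int c * b i) mod int p) mod int p = f i" for i
      using Suc.prems(3)[of i] by (simp add: mod_simps)
    then show ?case using add[OF g scale[OF b(1), of c]] by simp
  qed
  from this[of p f] f show ?thesis by simp
qed

lemma singles_full: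
  fixes D :: "(int \<Rightarrow> int) \<Rightarrow> bool"
  assumes p0: "p > 0" and n0: "n > 0"
    and zero: "D (\<lambda>i. 0)"
    and add: "\<And>f g. D f \<Longrightarrow> D g \<Longrightarrow> D (\<lambda>i. (f i + g i) mod int n)"
    and single: "\<And>k r. k < p \<Longrightarrow> D (\<lambda>i. if i mod int p = int k then r mod int n else 0)"
    and f: "periodic p f" "\<And>i. 0 \<le> f i \<and> f i < int n"
  shows "D f"
proof -
  have "m \<le> p \<Longrightarrow> D (\<lambda>i. if i mod int p < int m then f i else 0)" for m
  proof (induction m)
    case 0
    have "\<not> i mod int p < 0" for i using p0 by (simp add: not_less)
    then show ?case using zero by simp
  next
    case (Suc m)
    have fm: "f i mod int n = f i" for i using f(2)[of i] by simp
    have fi: "f (int m) = f i" if "i mod int p = int m" for i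
      using periodic_mod[OF f(1), of i] that by simp
    have "(\<lambda>i. if i mod int p < int (Suc m) then f i else 0) =
       (\<lambda>i. ((if i mod int p < int m then f i else 0) +
             (if i mod int p = int m then f (int m) mod int n else 0)) mod int n)"
      using fm fi by (intro ext) auto
    moreover have "m < p" using Suc.prems by simp
    ultimately show ?case using add[OF Suc.IH single[of m "f (int m)"]] Suc.prems by simp
  qed
  from this[of p] show ?thesis using p0 by simp
qed

section \<open>Affine monomial groups\<close>

text \<open>The group \<open>\<int>\<^sub>q ^ p \<rtimes> (\<int>\<^sub>p wr \<int>\<^sub>p)\<close>, where \<open>\<int>\<^sub>p wr \<int>\<^sub>p\<close> acts by monomial matrices with entries
  \<open>chi a\<close>, is described by coordinates of its elements: \<open>V x\<close> is the translation part, \<open>A x\<close>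
  gives the exponents of the diagonal part and \<open>C x\<close> is the cyclic shift. Vectors are periodic functions on the
  integers, with reduced values.  Leaving the underlying type open lets the same results apply
  to the quotient of the group by its trivial subgroup, the first step of the Fitting series.\<close>

locale affine_monomial =
  fixes G :: "('a, 'b) monoid_scheme" (structure)
    and p q :: nat and chi :: "int \<Rightarrow> int"
    and V A :: "'a \<Rightarrow> int \<Rightarrow> int" and C :: "'a \<Rightarrow> int"
  assumes prime_p: "Factorial_Ring.prime p" and p_ge_3: "p \<ge> 3" and prime_q: "Factorial_Ring.prime q"
    and chi_add: "[chi (s + t) = chi s * chi t] (mod int q)"
    and chi_eq_1_iff: "[chi s = 1] (mod int q) \<longleftrightarrow> int p dvd s"
    and mult_closed: "x \<in> carrier G \<Longrightarrow> y \<in> carrier G \<Longrightarrow> x \<otimes> y \<in> carrier G"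
    and unit_closed: "\<one> \<in> carrier G"
    and V_one: "V \<one> = (\<lambda>i. 0)" and A_one: "A \<one> = (\<lambda>i. 0)" and C_one: "C \<one> = 0"
    and V_periodic: "x \<in> carrier G \<Longrightarrow> periodic p (V x)"
    and A_periodic: "x \<in> carrier G \<Longrightarrow> periodic p (A x)"
    and V_range: "x \<in> carrier G \<Longrightarrow> 0 \<le> V x i \<and> V x i < int q"
    and A_range: "x \<in> carrier G \<Longrightarrow> 0 \<le> A x i \<and> A x i < int p"
    and C_range: "x \<in> carrier G \<Longrightarrow> 0 \<le> C x \<and> C x < int p"
    and V_mult: "x \<in> carrier G \<Longrightarrow> y \<in> carrier G \<Longrightarrow>
        V (x \<otimes> y) i = (V x i + chi (A x i) * V y (i - C x)) mod int q"
    and A_mult: "x \<in> carrier G \<Longrightarrow> y \<in> carrier G \<Longrightarrow>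
        A (x \<otimes> y) i = (A x i + A y (i - C x)) mod int p"
    and C_mult: "x \<in> carrier G \<Longrightarrow> y \<in> carrier G \<Longrightarrow> C (x \<otimes> y) = (C x + C y) mod int p"
    and coordinates_inject: "x \<in> carrier G \<Longrightarrow> y \<in> carrier G \<Longrightarrow>
        V x = V y \<Longrightarrow> A x = A y \<Longrightarrow> C x = C y \<Longrightarrow> x = y"
    and coordinates_ex: "periodic p v \<Longrightarrow> periodic p a \<Longrightarrow>
        \<exists>x\<in>carrier G. V x = (\<lambda>i. v i mod int q) \<and> A x = (\<lambda>i. a i mod int p) \<and> C x = c mod int p"
begin

lemma p_pos [simp]: "p > 0" and q_pos [simp]: "q > 0"
  using prime_p prime_q prime_gt_0_nat by auto

lemma V_mod [simp]: "x \<in> carrier G \<Longrightarrow> V x i mod int q = V x i"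
  using V_range[of x i] by simp

lemma A_mod [simp]: "x \<in> carrier G \<Longrightarrow> A x i mod int p = A x i"
  using A_range[of x i] by simp

lemma C_mod [simp]: "x \<in> carrier G \<Longrightarrow> C x mod int p = C x"
  using C_range[of x] by simp

lemma periodic_cong:
  assumes "periodic p f" "[i = j] (mod int p)"
  shows "f i = f j"
  using assms periodic_mod unfolding cong_def by metis

lemma V_cong: "x \<in> carrier G \<Longrightarrow> [i = j] (mod int p) \<Longrightarrow> V x i = V x j"
  using periodic_cong V_periodic by blast

lemma A_cong: "x \<in> carrier G \<Longrightarrow> [i = j] (mod int p) \<Longrightarrow> A x i = A x j"
  using periodic_cong A_periodic by blast

lemma chi_cong:
  assumes "[a = b] (mod int p)"
  shows "[chi a = chi b] (mod int q)"
proof -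
  have "[chi (b + (a - b)) = chi b * chi (a - b)] (mod int q)" by (rule chi_add)
  also have "[chi b * chi (a - b) = chi b * 1] (mod int q)"
    using assms chi_eq_1_iff by (intro cong_scalar_left) (simp add: cong_iff_dvd_diff)
  finally show ?thesis by simp
qed

lemma chi_0: "[chi 0 = 1] (mod int q)"
  by (simp add: chi_eq_1_iff)

lemma chi_0_mult [simp]: "(chi 0 * x) mod int q = x mod int q"
  using cong_scalar_right[OF chi_0, of x] by (simp add: cong_def)

lemma chi_0_add_mult [simp]: "(y + chi 0 * x) mod int q = (y + x) mod int q"
  using chi_0_mult[of x] by (metis mod_add_right_eq)

lemma chi_1: "\<not> [chi 1 = 1] (mod int q)"
  using chi_eq_1_iff[of 1] p_ge_3 by simp

lemma group: "group G"
proof (rule groupI)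
  fix x y z assume x: "x \<in> carrier G" and y: "y \<in> carrier G" and z: "z \<in> carrier G"
  show "x \<otimes> y \<otimes> z = x \<otimes> (y \<otimes> z)"
  proof (rule coordinates_inject)
    show "V (x \<otimes> y \<otimes> z) = V (x \<otimes> (y \<otimes> z))"
    proof
      fix i
      let ?j = "i - C x"
      have s: "V z (i - (C x + C y) mod int p) = V z (?j - C y)"
        by (rule V_cong[OF z]) (simp add: cong_def mod_simps algebra_simps)
      have "[chi ((A x i + A y ?j) mod int p) = chi (A x i + A y ?j)] (mod int q)"
        by (rule chi_cong) (simp add: cong_def)
      also have "[chi (A x i + A y ?j) = chi (A x i) * chi (A y ?j)] (mod int q)"
        by (rule chi_add)
      finally have "[V x i + chi (A x i) * V y ?j + chi ((A x i + A y ?j) mod int p) * V z (?j - C y) =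
          V x i + chi (A x i) * V y ?j + chi (A x i) * chi (A y ?j) * V z (?j - C y)] (mod int q)"
        by (intro cong_add cong_mult cong_refl)
      then have e: "(V x i + chi (A x i) * V y ?j + chi ((A x i + A y ?j) mod int p) * V z (?j - C y)) mod int q =
          (V x i + chi (A x i) * (V y ?j + chi (A y ?j) * V z (?j - C y))) mod int q"
        by (simp add: cong_def distrib_left mult.assoc add.assoc)
      have "V (x \<otimes> (y \<otimes> z)) i =
          (V x i + chi (A x i) * ((V y ?j + chi (A y ?j) * V z (?j - C y)) mod int q)) mod int q"
        using x y z by (simp add: V_mult mult_closed)
      also have "\<dots> = (V x i + chi (A x i) * (V y ?j + chi (A y ?j) * V z (?j - C y))) mod int q"
        by (metis mod_add_right_eq mod_mult_right_eq)
      finally show "V (x \<otimes> y \<otimes> z) i = V (x \<otimes> (y \<otimes> z)) i"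
        using x y z s e by (simp add: V_mult A_mult C_mult mult_closed mod_simps)
    qed
    show "A (x \<otimes> y \<otimes> z) = A (x \<otimes> (y \<otimes> z))"
    proof
      fix i
      have s: "A z (i - (C x + C y) mod int p) = A z (i - C x - C y)"
        by (rule A_cong[OF z]) (simp add: cong_def mod_simps algebra_simps)
      then show "A (x \<otimes> y \<otimes> z) i = A (x \<otimes> (y \<otimes> z)) i"
        using x y z by (simp add: A_mult C_mult mult_closed mod_simps algebra_simps)
    qed
  qed (use x y z in \<open>simp_all add: C_mult mult_closed mod_simps add.assoc\<close>)
next
  fix x assume x: "x \<in> carrier G"
  show "\<one> \<otimes> x = x"
    using x by (intro coordinates_inject)
      (auto simp: V_mult A_mult C_mult mult_closed unit_closed V_one A_one C_one)
  \<comment> \<open>This solves \<open>y \<otimes> x = \<one>\<close> coordinate by coordinate; the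
    double negation brings the argument into the form of \<open>periodic_shift\<close>.\<close>
  let ?v = "\<lambda>i. - chi (- A x (i - (- C x))) * V x (i - (- C x))" and ?a = "\<lambda>i. - A x (i - (- C x))"
  have "periodic p ?a" "periodic p ?v"
    using periodic_shift[OF A_periodic[OF x], of "- C x"] periodic_shift[OF V_periodic[OF x], of "- C x"]
    unfolding periodic_def by presburger+
  then obtain y where y: "y \<in> carrier G" "V y = (\<lambda>i. ?v i mod int q)"
      "A y = (\<lambda>i. ?a i mod int p)" "C y = (- C x) mod int p"
    using coordinates_ex by blast
  have "y \<otimes> x = \<one>"
  proof (rule coordinates_inject)
    show "V (y \<otimes> x) = V \<one>"
    proof
      fix i
      have s: "V x (i - (- C x) mod int p) = V x (i + C x)"
        by (rule V_cong[OF x]) (simp add: cong_def mod_simps)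
      have "[chi ((- A x (i + C x)) mod int p) = chi (- A x (i + C x))] (mod int q)"
        by (rule chi_cong) (simp add: cong_def)
      then have "[- chi (- A x (i + C x)) * V x (i + C x) + chi ((- A x (i + C x)) mod int p) * V x (i + C x) =
         - chi (- A x (i + C x)) * V x (i + C x) + chi (- A x (i + C x)) * V x (i + C x)] (mod int q)"
        by (intro cong_add cong_mult cong_refl)
      then show "V (y \<otimes> x) i = V \<one> i"
        using s by (simp add: V_mult x y(1)) (simp add: y V_one mod_simps cong_def)
    qed
    show "A (y \<otimes> x) = A \<one>"
    proof
      fix i
      have s: "A x (i - (- C x) mod int p) = A x (i + C x)"
        by (rule A_cong[OF x]) (simp add: cong_def mod_simps)
      then show "A (y \<otimes> x) i = A \<one> i"
        by (simp add: A_mult x y(1)) (simp add: y A_one mod_simps)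
    qed
  qed (use x y(1) in \<open>simp_all add: C_mult y(4) mult_closed unit_closed C_one mod_simps\<close>)
  then show "\<exists>y\<in>carrier G. y \<otimes> x = \<one>" using y(1) by blast
qed (simp_all add: mult_closed unit_closed)

end

sublocale affine_monomial \<subseteq> group G
  by (rule group)

context affine_monomial
begin

definition mk :: "(int \<Rightarrow> int) \<Rightarrow> (int \<Rightarrow> int) \<Rightarrow> int \<Rightarrow> 'a" where
  "mk v a c = (SOME x. x \<in> carrier G \<and>
     V x = (\<lambda>i. v i mod int q) \<and> A x = (\<lambda>i. a i mod int p) \<and> C x = c mod int p)"

lemma mk:
  assumes "periodic p v" "periodic p a"
  shows "mk v a c \<in> carrier G" "V (mk v a c) i = v i mod int q"
    "A (mk v a c) i = a i mod int p" "C (mk v a c) = c mod int p"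
proof -
  have "mk v a c \<in> carrier G \<and> V (mk v a c) = (\<lambda>i. v i mod int q) \<and>
      A (mk v a c) = (\<lambda>i. a i mod int p) \<and> C (mk v a c) = c mod int p"
    unfolding mk_def by (rule someI_ex) (use coordinates_ex[OF assms, of c] in auto)
  then show "mk v a c \<in> carrier G" "V (mk v a c) i = v i mod int q"
    "A (mk v a c) i = a i mod int p" "C (mk v a c) = c mod int p" by auto
qed

definition single :: "int \<Rightarrow> int \<Rightarrow> int \<Rightarrow> int" where
  "single k r i = (if i mod int p = k mod int p then r else 0)"

lemma periodic_single [simp]: "periodic p (single k r)"
  by (simp add: periodic_def single_def)

lemma periodic_const [simp]: "periodic p (\<lambda>i. c)"
  by (simp add: periodic_def)

section \<open>Coordinates of quotients, commutators and conjugates\<close>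

lemmas mult_coordinates = V_mult A_mult C_mult

lemma C_inv: "x \<in> carrier G \<Longrightarrow> C (inv x) = (- C x) mod int p"
proof -
  assume x: "x \<in> carrier G"
  have "(C (inv x) + C x) mod int p = 0"
    using C_mult[of "inv x" x] x by (simp add: C_one)
  then have "[C (inv x) = - C x] (mod int p)"
    by (simp add: cong_iff_dvd_diff mod_0_imp_dvd)
  then show ?thesis using x by (simp add: cong_def)
qed

lemma C_div:
  assumes "x \<in> carrier G" "y \<in> carrier G"
  shows "C (x \<otimes> inv y) = (C x - C y) mod int p"
  using assms by (simp add: C_mult C_inv mod_simps)

lemma A_div:
  assumes "x \<in> carrier G" "y \<in> carrier G" "C x = C y"
  shows "A (x \<otimes> inv y) i = (A x i - A y i) mod int p"
proof -
  let ?z = "x \<otimes> inv y"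
  have z: "?z \<in> carrier G" "C ?z = 0" using assms by (simp_all add: C_div)
  have "x = ?z \<otimes> y" using assms by (simp add: m_assoc)
  then have "A x i = (A ?z i + A y i) mod int p"
    using A_mult[OF z(1) assms(2), of i] z(2) by simp
  then have "(A x i - A y i) mod int p = A ?z i mod int p"
    by (simp add: mod_simps)
  then show ?thesis using z by simp
qed

definition VV :: "'a set" where
  "VV = {x \<in> carrier G. A x = (\<lambda>i. 0) \<and> C x = 0}"

lemma div_in_VV:
  assumes "x \<in> carrier G" "y \<in> carrier G" "A x = A y" "C x = C y"
  shows "x \<otimes> inv y \<in> VV" "V (x \<otimes> inv y) i = (V x i - V y i) mod int q"
proof -
  let ?z = "x \<otimes> inv y"
  have z: "?z \<in> carrier G" "C ?z = 0" "A ?z = (\<lambda>i. 0)" using assms by (auto simp: C_div A_div)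
  then show "?z \<in> VV" by (simp add: VV_def)
  have "x = ?z \<otimes> y" using assms by (simp add: m_assoc)
  then have "V x i = (V ?z i + V y i) mod int q"
    using V_mult[OF z(1) assms(2), of i] z by simp
  then have "(V x i - V y i) mod int q = V ?z i mod int q"
    by (simp add: mod_simps)
  then show "V (x \<otimes> inv y) i = (V x i - V y i) mod int q" using z by simp
qed

text \<open>As a quotient of xy by yx, two products with equal shift, the commutator falls under the
  rules for quotients.\<close>

lemma commutator_eq:
  assumes "x \<in> carrier G" "y \<in> carrier G"
  shows "x \<otimes> y \<otimes> inv x \<otimes> inv y = (x \<otimes> y) \<otimes> inv (y \<otimes> x)"
  using assms by (simp add: inv_mult_group m_assoc)

lemma C_commutator:
  assumes "x \<in> carrier G" "y \<in> carrier G"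
  shows "C (x \<otimes> y \<otimes> inv x \<otimes> inv y) = 0"
  unfolding commutator_eq[OF assms] C_div[OF m_closed[OF assms] m_closed[OF assms(2,1)]]
  using assms by (simp add: C_mult add.commute)

lemma A_commutator:
  assumes "x \<in> carrier G" "y \<in> carrier G"
  shows "A (x \<otimes> y \<otimes> inv x \<otimes> inv y) i =
     (A x i + A y (i - C x) - A y i - A x (i - C y)) mod int p"
proof -
  have C: "C (x \<otimes> y) = C (y \<otimes> x)" using assms by (simp add: C_mult add.commute)
  show ?thesis
    unfolding commutator_eq[OF assms] A_div[OF m_closed[OF assms] m_closed[OF assms(2,1)] C]
    using assms by (simp add: A_mult mod_simps algebra_simps)
qed

lemma VV_commutator:
  assumes x: "x \<in> carrier G" and w: "w \<in> VV"
  shows "x \<otimes> w \<otimes> inv x \<otimes> inv w \<in> VV"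
    "V (x \<otimes> w \<otimes> inv x \<otimes> inv w) i = (chi (A x i) * V w (i - C x) - V w i) mod int q"
proof -
  have w': "w \<in> carrier G" "A w = (\<lambda>i. 0)" "C w = 0" using w by (auto simp: VV_def)
  have A: "A (x \<otimes> w) = A (w \<otimes> x)" and C: "C (x \<otimes> w) = C (w \<otimes> x)"
    using w' x by (auto simp: A_mult C_mult)
  note * = div_in_VV[OF m_closed m_closed A C, OF x w'(1) w'(1) x]
  show "x \<otimes> w \<otimes> inv x \<otimes> inv w \<in> VV"
    unfolding commutator_eq[OF x w'(1)] by (rule *(1))
  show "V (x \<otimes> w \<otimes> inv x \<otimes> inv w) i = (chi (A x i) * V w (i - C x) - V w i) mod int q"
    unfolding commutator_eq[OF x w'(1)] *(2) using x w' by (simp add: V_mult mod_simps)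
qed

lemma VV_subset: "VV \<subseteq> carrier G"
  by (auto simp: VV_def)

lemma VV_mult:
  assumes "x \<in> VV" "y \<in> VV"
  shows "x \<otimes> y \<in> VV" "V (x \<otimes> y) i = (V x i + V y i) mod int q"
  using assms by (auto simp: VV_def mult_coordinates)

lemma VV_conj:
  assumes x: "x \<in> carrier G" and w: "w \<in> VV"
  shows "x \<otimes> w \<otimes> inv x \<in> VV" "V (x \<otimes> w \<otimes> inv x) i = (chi (A x i) * V w (i - C x)) mod int q"
proof -
  have wc: "w \<in> carrier G" using w VV_subset by auto
  have "x \<otimes> w \<otimes> inv x = (x \<otimes> w \<otimes> inv x \<otimes> inv w) \<otimes> w"
    using x wc by (simp add: m_assoc)
  moreover have "(x \<otimes> w \<otimes> inv x \<otimes> inv w) \<otimes> w \<in> VV"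
      "V ((x \<otimes> w \<otimes> inv x \<otimes> inv w) \<otimes> w) i = (chi (A x i) * V w (i - C x)) mod int q"
    using VV_mult[OF VV_commutator(1)[OF x w] w] VV_commutator(2)[OF x w] wc
    by (simp_all add: mod_simps)
  ultimately show "x \<otimes> w \<otimes> inv x \<in> VV"
      "V (x \<otimes> w \<otimes> inv x) i = (chi (A x i) * V w (i - C x)) mod int q"
    by (simp_all only:)
qed

lemma C_conj:
  assumes "x \<in> carrier G" "u \<in> carrier G"
  shows "C (x \<otimes> u \<otimes> inv x) = C u"
  using assms by (simp add: C_mult C_inv mod_simps)

lemma A_conj:
  assumes "x \<in> carrier G" "u \<in> carrier G" "C u = 0"
  shows "A (x \<otimes> u \<otimes> inv x) i = A u (i - C x)"
proof -
  have "x \<otimes> u \<otimes> inv x = (x \<otimes> u \<otimes> inv x \<otimes> inv u) \<otimes> u"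
    using assms by (simp add: m_assoc)
  moreover have "A ((x \<otimes> u \<otimes> inv x \<otimes> inv u) \<otimes> u) i = A u (i - C x)"
    using assms A_mult[of "x \<otimes> u \<otimes> inv x \<otimes> inv u" u i] C_commutator[OF assms(1,2)]
      A_commutator[OF assms(1,2), of i] by (simp add: mod_simps del: A_mult)
  ultimately show ?thesis by (rule ssubst)
qed

lemma C_pow:
  assumes "x \<in> carrier G"
  shows "C (x [^] (n::nat)) = (int n * C x) mod int p"
  by (induction n) (use assms in \<open>simp_all add: C_one C_mult mod_simps algebra_simps\<close>)

lemma VV_pow:
  assumes "w \<in> VV"
  shows "w [^] (n::nat) \<in> VV \<and> V (w [^] n) i = (int n * V w i) mod int q"
proof (induction n)
  case 0
  then show ?case by (simp add: VV_def V_one A_one C_one)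
next
  case (Suc n)
  then show ?case using VV_mult[of "w [^] n" w] assms by (simp add: mod_simps algebra_simps)
qed

text \<open>Together with \<open>C\<close> this is the abelianization of H. It is elementary abelian
  of order p^2, so it is also the Frattini quotient of H.\<close>

definition S :: "'a \<Rightarrow> int" where
  "S x = moment p 0 (A x) mod int p"

lemma S_mult:
  assumes "x \<in> carrier G" "y \<in> carrier G"
  shows "S (x \<otimes> y) = (S x + S y) mod int p"
proof -
  have "[moment p 0 (\<lambda>i. A y (i - C x)) = moment p 0 (A y)] (mod int p)"
    using moment_shift[OF A_periodic[OF assms(2)], of 0 "C x"] by simp
  then have "[moment p 0 (\<lambda>i. A x i + A y (i - C x)) = moment p 0 (A x) + moment p 0 (A y)] (mod int p)"
    unfolding moment_add by (intro cong_add cong_refl)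
  moreover have "A (x \<otimes> y) = (\<lambda>i. (A x i + A y (i - C x)) mod int p)"
    using assms by (auto simp: A_mult)
  ultimately show ?thesis
    using moment_mod[of p 0 "\<lambda>i. A x i + A y (i - C x)"]
    by (simp add: S_def cong_def mod_simps)
qed

lemma S_one: "S \<one> = 0"
  by (simp add: S_def A_one moment_def)

lemma S_pow:
  assumes "x \<in> carrier G"
  shows "S (x [^] (n::nat)) = (int n * S x) mod int p"
  by (induction n) (use assms in \<open>simp_all add: S_one S_mult mod_simps algebra_simps\<close>)

lemma single_moment_0: "moment p 0 (single k r) = r"
proof -
  have "moment p 0 (single k r) = (\<Sum>i\<in>{0..<int p}. if i = k mod int p then r else 0)"
    unfolding moment_def single_def by (intro sum.cong) auto
  also have "\<dots> = r" by (simp add: sum.delta)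
  finally show ?thesis .
qed

section \<open>Subgroups that cover the quotient by the translations\<close>

text \<open>\<open>full K\<close> says that \<open>K\<close> covers the quotient by \<open>VV\<close>.\<close>

definition full :: "'a set \<Rightarrow> bool" where
  "full K \<longleftrightarrow> (\<forall>y\<in>carrier G. \<exists>x\<in>K. A x = A y \<and> C x = C y)"

lemma fullD:
  assumes "full K" "periodic p a"
  obtains x where "x \<in> K" "\<And>i. A x i = a i mod int p" "C x = c mod int p"
proof -
  have "mk (\<lambda>i. 0) a c \<in> carrier G" using mk(1) assms(2) by simp
  then obtain x where "x \<in> K" "A x = A (mk (\<lambda>i. 0) a c)" "C x = C (mk (\<lambda>i. 0) a c)"
    using assms(1) unfolding full_def by metis
  then show ?thesis using that[of x] assms(2) mk by simp
qed

text \<open>A power of \<open>x\<close> has shift 1, and conjugation by it rotates the exponent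
  vector of a shiftless element, whatever its own diagonal part is. So the exponent vectors of
  shiftless elements of \<open>K\<close> form a shift-invariant set, and \<open>A y\<close> has
  nonzero sum: \<open>shift_invariant_full\<close> applies. Powers of \<open>x\<close> supply the
  shifts.\<close>

lemma fullI:
  assumes K: "subgroup K G" and x: "x \<in> K" "C x \<noteq> 0" and y: "y \<in> K" "C y = 0" "S y \<noteq> 0"
  shows "full K"
proof -
  have Kc: "u \<in> carrier G" if "u \<in> K" for u by (rule subgroup.mem_carrier[OF K that])
  have pw: "u [^] (n::nat) \<in> K" if "u \<in> K" for u n
    by (induction n) (use that in \<open>auto intro: subgroup.one_closed[OF K] subgroup.m_closed[OF K]\<close>)
  have "\<not> int p dvd C x" using C_range[OF Kc[OF x(1)]] x(2) zdvd_not_zless by auto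
  then obtain n where n: "[int n * C x = 1] (mod int p)" using prime_modulus_coefficient prime_p by metis
  define x1 where "x1 = x [^] n"
  have x1: "x1 \<in> K" "C x1 = 1" "x1 \<in> carrier G"
    using pw x Kc n p_ge_3 by (auto simp: x1_def C_pow cong_def)
  define D where "D f \<longleftrightarrow> (\<exists>u\<in>K. C u = 0 \<and> A u = f)" for f
  have D: "D f" if "periodic p f" "\<And>i. 0 \<le> f i \<and> f i < int p" for f
  proof (rule shift_invariant_full[where D=D and f=f and p=p and b="A y"])
    show "D (A y)" using y by (auto simp: D_def)
    show "\<not> int p dvd moment p 0 (A y)" using y by (auto simp: S_def dvd_eq_mod_eq_0)
    show "periodic p f" if "D f" for f using that A_periodic Kc by (auto simp: D_def)
    fix f assume f: "D f"
    then obtain u where u: "u \<in> K" "C u = 0" "A u = f" by (auto simp: D_def)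
    show "D (\<lambda>i. f (i - 1))"
      unfolding D_def
    proof (intro bexI conjI)
      show "x1 \<otimes> u \<otimes> inv x1 \<in> K"
        using u x1 K by (simp add: subgroup.m_closed[OF K] subgroup.m_inv_closed[OF K])
    qed (use u x1 Kc in \<open>auto simp: C_conj A_conj\<close>)
    fix g assume "D g"
    then obtain w where w: "w \<in> K" "C w = 0" "A w = g" by (auto simp: D_def)
    show "D (\<lambda>i. (f i + g i) mod int p)"
      unfolding D_def
      by (rule bexI[of _ "u \<otimes> w"]) (use u w Kc in \<open>auto simp: C_mult A_mult subgroup.m_closed[OF K]\<close>)
  qed (use that prime_p in auto)
  show ?thesis
    unfolding full_def
  proof
    fix z assume z: "z \<in> carrier G"
    obtain m where m: "C z = int m" using C_range[OF z] zero_le_imp_eq_int by blast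
    define w where "w = x1 [^] m"
    have w: "w \<in> K" "w \<in> carrier G" "C w = C z"
      using pw x1 Kc C_mod[OF z] by (auto simp: w_def C_pow m)
    have "D (\<lambda>i. (A z i - A w i) mod int p)"
      using A_periodic[OF z] A_periodic[OF w(2)] by (intro D) (auto simp: periodic_def)
    then obtain u where u: "u \<in> K" "C u = 0" "A u = (\<lambda>i. (A z i - A w i) mod int p)"
      by (auto simp: D_def)
    show "\<exists>x\<in>K. A x = A z \<and> C x = C z"
    proof (intro bexI conjI)
      show "u \<otimes> w \<in> K" using u w by (simp add: subgroup.m_closed[OF K])
    qed (use u w Kc z in \<open>auto simp: A_mult C_mult mod_simps\<close>)
  qed
qed

text \<open>This is the irreducibility of V. Take a coordinate k where \<open>w\<close> is nonzero
  and an \<open>x\<close> in \<open>K\<close> that scales only this coordinate, by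
  \<open>chi 1\<close>. The commutator of \<open>x\<close> and \<open>w\<close> is a multiple of the
  k-th unit vector, nonzero because \<open>chi 1 - 1\<close> is invertible modulo q. Conjugates by
  shifts and powers then produce all of \<open>VV\<close>.\<close>

lemma full_meets_VV:
  assumes K: "subgroup K G" and full: "full K" and w: "w \<in> K" "w \<in> VV" "w \<noteq> \<one>"
  shows "K = carrier G"
proof -
  have Kc: "u \<in> carrier G" if "u \<in> K" for u by (rule subgroup.mem_carrier[OF K that])
  have pw: "u [^] (n::nat) \<in> K" if "u \<in> K" for u n
    by (induction n) (use that in \<open>auto intro: subgroup.one_closed[OF K] subgroup.m_closed[OF K]\<close>)
  have "V w \<noteq> (\<lambda>i. 0)"
    using w coordinates_inject[of w \<one>] by (auto simp: VV_def V_one A_one C_one)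
  then obtain k where k: "V w k \<noteq> 0" by auto
  obtain x where x: "x \<in> K" "\<And>i. A x i = single k 1 i mod int p" "C x = 0 mod int p"
    using fullD[OF full periodic_single] by blast
  define w1 where "w1 = x \<otimes> w \<otimes> inv x \<otimes> inv w"
  define r where "r = ((chi 1 - 1) * V w k) mod int q"
  have w1: "w1 \<in> K" "w1 \<in> VV"
    using K x w VV_commutator(1)[of x w] Kc
    by (auto simp: w1_def subgroup.m_closed[OF K] subgroup.m_inv_closed[OF K])
  have r: "V w1 i = single k r i" for i
  proof (cases "[i = k] (mod int p)")
    case True
    then have "A x i = 1" using x(2) p_ge_3 by (simp add: single_def cong_def)
    then show ?thesis
      using VV_commutator(2)[of x w i] x Kc w True V_cong[of w i k]
      by (simp add: w1_def r_def single_def cong_def algebra_simps)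
  next
    case False
    then have "A x i = 0" using x(2) by (simp add: single_def cong_def)
    then show ?thesis
      using VV_commutator(2)[of x w i] x Kc w False chi_0_mult[of "V w i"]
      by (simp add: w1_def single_def cong_def) (metis cong_def chi_0_mult diff_self mod_0 mod_diff_left_eq)
  qed
  have "\<not> int q dvd (chi 1 - 1) * V w k"
  proof
    assume "int q dvd (chi 1 - 1) * V w k"
    then have "int q dvd chi 1 - 1 \<or> int q dvd V w k"
      using prime_q prime_dvd_mult_iff[of "int q"] by auto
    then show False
      using chi_1 k V_range[of w k] w Kc zdvd_not_zless[of "V w k" "int q"]
      by (auto simp: cong_iff_dvd_diff less_le)
  qed
  then have rq: "\<not> int q dvd r" by (simp add: r_def dvd_mod_iff)
  define D where "D f \<longleftrightarrow> (\<exists>u\<in>K. u \<in> VV \<and> V u = f)" for f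
  have D: "D f" if "periodic p f" "\<And>i. 0 \<le> f i \<and> f i < int q" for f
  proof (rule singles_full[where D=D and f=f and p=p and n=q])
    show "D (\<lambda>i. 0)"
      unfolding D_def by (intro bexI[of _ \<one>]) (auto simp: VV_def V_one A_one C_one subgroup.one_closed[OF K])
    show "D (\<lambda>i. (f i + g i) mod int q)" if fg: "D f" "D g" for f g
    proof -
      from fg obtain u t where "u \<in> K" "u \<in> VV" "V u = f" "t \<in> K" "t \<in> VV" "V t = g"
        by (auto simp: D_def)
      then show ?thesis unfolding D_def
        by (intro bexI[of _ "u \<otimes> t"]) (auto simp: VV_mult subgroup.m_closed[OF K])
    qed
    fix j :: nat and s :: int
    \<comment> \<open>A shift by j - k moves the coordinate k to the coordinate j.\<close>
    obtain y where y: "y \<in> K" "\<And>i. A y i = 0 mod int p" "C y = (int j - k) mod int p"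
      using fullD[OF full periodic_const] by metis
    define u where "u = y \<otimes> w1 \<otimes> inv y"
    have u: "u \<in> K" "u \<in> VV"
      using VV_conj[of y w1] y w1 Kc by (auto simp: u_def subgroup.m_closed[OF K] subgroup.m_inv_closed[OF K])
    have uV: "V u i = single j r i" for i
    proof -
      have "(i - C y) mod int p = k mod int p \<longleftrightarrow> i mod int p = int j mod int p"
        unfolding y(3) mod_diff_right_eq using mod_eq_dvd_iff[of "i - (int j - k)" "int p" k]
          mod_eq_dvd_iff[of i "int p" "int j"] by (simp add: algebra_simps)
      then have "single k r (i - C y) = single (int j) r i" by (simp add: single_def)
      then show ?thesis
        using VV_conj(2)[of y w1 i] y w1 Kc r by (simp add: u_def single_def r_def)
    qed
    obtain n where n: "[int n * r = s] (mod int q)"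
      using prime_modulus_coefficient[OF prime_q rq] .
    show "D (\<lambda>i. if i mod int p = int j then s mod int q else 0)" if "j < p"
      unfolding D_def
    proof (intro bexI conjI)
      show "u [^] n \<in> K" "u [^] n \<in> VV" using pw u VV_pow by blast+
      show "V (u [^] n) = (\<lambda>i. if i mod int p = int j then s mod int q else 0)"
        using VV_pow[OF u(2)] uV n that by (auto simp: single_def cong_def)
    qed
  qed (use that in auto)
  show ?thesis
  proof
    show "carrier G \<subseteq> K"
    proof
      fix y assume y: "y \<in> carrier G"
      obtain x where x: "x \<in> K" "A y = A x" "C y = C x"
        using full y unfolding full_def by metis
      define z where "z = y \<otimes> inv x"
      have z: "z \<in> VV" using div_in_VV[OF y Kc x(2,3)] x by (simp add: z_def)
      have "D (V z)" using V_periodic V_range z VV_subset by (intro D) auto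
      then obtain u where u: "u \<in> K" "u \<in> VV" "V u = V z" by (auto simp: D_def)
      then have "z = u" using coordinates_inject[of z u] z by (auto simp: VV_def)
      then have "z \<otimes> x \<in> K" using u x by (simp add: subgroup.m_closed[OF K])
      moreover have "z \<otimes> x = y" using x Kc y by (simp add: z_def m_assoc)
      ultimately show "y \<in> K" by simp
    qed
  qed (use Kc in blast)
qed

section \<open>Irredundant sequences\<close>

lemma card_carrier: "card (carrier G) = q ^ p * (p ^ p * p)" and finite_carrier: "finite (carrier G)"
proof -
  let ?R = "\<lambda>n. {f. periodic p f \<and> (\<forall>i. 0 \<le> f i \<and> f i < int n)}"
  have bij: "bij_betw (\<lambda>x. (V x, A x, C x)) (carrier G) (?R q \<times> ?R p \<times> {0..<int p})"
    unfolding bij_betw_def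
  proof
    show "inj_on (\<lambda>x. (V x, A x, C x)) (carrier G)"
      by (rule inj_onI) (auto intro: coordinates_inject)
    show "(\<lambda>x. (V x, A x, C x)) ` carrier G = ?R q \<times> ?R p \<times> {0..<int p}"
    proof (intro equalityI subsetI)
      fix t assume t: "t \<in> ?R q \<times> ?R p \<times> {0..<int p}"
      obtain v a c where vac: "t = (v, a, c)" by (cases t)
      with t have "periodic p v" "periodic p a" "c mod int p = c"
        "\<And>i. v i mod int q = v i" "\<And>i. a i mod int p = a i" by auto
      then have "t = (\<lambda>x. (V x, A x, C x)) (mk v a c)" "mk v a c \<in> carrier G"
        using mk[of v a c] by (auto simp: vac)
      then show "t \<in> (\<lambda>x. (V x, A x, C x)) ` carrier G" by blast
    qed (auto simp: V_periodic A_periodic V_range A_range C_range)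
  qed
  show "card (carrier G) = q ^ p * (p ^ p * p)"
    using bij_betw_same_card[OF bij] by (simp add: card_cartesian_product card_reduced_periodic)
  have "finite (?R q \<times> ?R p \<times> {0..<int p})"
    by (intro finite_cartesian_product card_reduced_periodic) auto
  then show "finite (carrier G)" using bij_betw_finite[OF bij] by simp
qed

lemma Omega_carrier: "Omega (card (carrier G)) = 2 * p + 1"
proof -
  have "p ^ p * p = p ^ (p + 1)" by simp
  then have "Omega (card (carrier G)) = Omega (q ^ p) + Omega (p ^ (p + 1))"
    using prime_factorization_mult[of "q ^ p" "p ^ (p + 1)"] by (simp add: card_carrier mult.commute)
  then show ?thesis using Omega_prime_power prime_p prime_q by (simp del: power_Suc)
qed

text \<open>The preimage in G of the zero set of a linear form on the Frattini quotient, a line when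
  the form is nonzero modulo p.\<close>

definition line :: "int \<Rightarrow> int \<Rightarrow> 'a set" where
  "line \<alpha> \<beta> = {x \<in> carrier G. int p dvd \<alpha> * S x + \<beta> * C x}"

lemma line_subgroup: "subgroup (line \<alpha> \<beta>) G"
proof (rule finite_subgroupI[OF finite_carrier])
  fix x y assume x: "x \<in> line \<alpha> \<beta>" and y: "y \<in> line \<alpha> \<beta>"
  have xy: "x \<in> carrier G" "y \<in> carrier G" using x y by (auto simp: line_def)
  have "[S (x \<otimes> y) = S x + S y] (mod int p)" "[C (x \<otimes> y) = C x + C y] (mod int p)"
    using xy by (simp_all add: S_mult C_mult cong_def)
  then have "[\<alpha> * S (x \<otimes> y) + \<beta> * C (x \<otimes> y) = \<alpha> * (S x + S y) + \<beta> * (C x + C y)] (mod int p)"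
    by (intro cong_add cong_mult cong_refl)
  also have "\<alpha> * (S x + S y) + \<beta> * (C x + C y) = (\<alpha> * S x + \<beta> * C x) + (\<alpha> * S y + \<beta> * C y)"
    by (simp add: algebra_simps)
  finally have e: "[\<alpha> * S (x \<otimes> y) + \<beta> * C (x \<otimes> y) =
      (\<alpha> * S x + \<beta> * C x) + (\<alpha> * S y + \<beta> * C y)] (mod int p)" .
  have "int p dvd (\<alpha> * S x + \<beta> * C x) + (\<alpha> * S y + \<beta> * C y)"
    using x y dvd_add unfolding line_def mem_Collect_eq by blast
  then show "x \<otimes> y \<in> line \<alpha> \<beta>" using e xy cong_dvd_iff by (auto simp: line_def)
qed (auto simp: line_def S_one C_one)

lemma prime_int_p: "Factorial_Ring.prime (int p)"
  using prime_p by simp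

lemma line_0_1: "x \<in> line 0 1 \<longleftrightarrow> x \<in> carrier G \<and> C x = 0"
  using not_dvd_small[of "C x" p] C_range[of x] by (auto simp: line_def)

text \<open>The elements \<open>ev 0\<close>, \<open>dl 0\<close> and \<open>sh\<close> generate G
  irredundantly; all \<open>ev k\<close> and \<open>dl k\<close> with k < p together attain the
  length 2p.\<close>

definition ev :: "int \<Rightarrow> 'a" where "ev k = mk (single k 1) (\<lambda>i. 0) 0"
definition dl :: "int \<Rightarrow> 'a" where "dl k = mk (\<lambda>i. 0) (single k 1) 0"
definition sh :: "'a" where "sh = mk (\<lambda>i. 0) (\<lambda>i. 0) 1"

lemma p_gt_1 [simp]: "p > 1" "Suc 0 < p" "p \<noteq> Suc 0" and q_gt_1 [simp]: "q > 1" "Suc 0 < q"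
  using prime_gt_1_nat[OF prime_p] prime_gt_1_nat[OF prime_q] by simp_all

lemma single_mod: "n > 1 \<Longrightarrow> single k 1 i mod int n = single k 1 i"
  by (simp add: single_def)

lemma ev: "ev k \<in> carrier G" "V (ev k) = single k 1" "A (ev k) = (\<lambda>i. 0)" "C (ev k) = 0"
  and dl: "dl k \<in> carrier G" "V (dl k) = (\<lambda>i. 0)" "A (dl k) = single k 1" "C (dl k) = 0"
  and sh: "sh \<in> carrier G" "V sh = (\<lambda>i. 0)" "A sh = (\<lambda>i. 0)" "C sh = 1"
  unfolding ev_def dl_def sh_def by (auto simp: mk single_mod)

lemma ev_VV: "ev k \<in> VV"
  by (simp add: VV_def ev)

lemma S_dl: "S (dl k) = 1"
  by (simp add: S_def dl single_moment_0)

lemma ev_neq_one: "ev k \<noteq> \<one>"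
  using ev(2)[of k] V_one by (metis single_def zero_neq_one)

text \<open>Multiplying \<open>y\<close> by a power of \<open>x\<close> removes its shift and does
  not change the determinant modulo p. For a shiftless second element a nonzero determinant means a
  nonzero \<open>S\<close>, as \<open>fullI\<close> requires.\<close>

lemma full_of_det:
  assumes K: "subgroup K G" and x: "x \<in> K" "C x \<noteq> 0" and y: "y \<in> K"
    and det: "\<not> int p dvd S x * C y - S y * C x"
  shows "full K"
proof -
  have c: "x \<in> carrier G" "y \<in> carrier G" using subgroup.mem_carrier[OF K] x y by auto
  have "\<not> int p dvd C x" using C_range[OF c(1)] x(2) not_dvd_small by blast
  then obtain n where n: "[int n * C x = - C y] (mod int p)" using prime_modulus_coefficient prime_p by metis
  define z where "z = y \<otimes> x [^] n"
  have "x [^] n \<in> K" by (induction n) (use x in \<open>auto intro: subgroup.one_closed[OF K] subgroup.m_closed[OF K]\<close>)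
  then have z: "z \<in> K" using y by (simp add: z_def subgroup.m_closed[OF K])
  have "int p dvd C y + int n * C x" using n by (simp add: cong_iff_dvd_diff add.commute)
  then have "C z = 0" using c by (simp add: z_def C_mult C_pow mod_simps)
  moreover have "S z \<noteq> 0"
  proof
    assume "S z = 0"
    then have "int p dvd S y + int n * S x"
      using c by (simp add: z_def S_mult S_pow mod_simps dvd_eq_mod_eq_0)
    then have "int p dvd (C y + int n * C x) * S x - (S y + int n * S x) * C x"
      using \<open>int p dvd C y + int n * C x\<close> by (intro dvd_diff dvd_mult2)
    also have "(C y + int n * C x) * S x - (S y + int n * S x) * C x = S x * C y - S y * C x"
      by (simp add: algebra_simps)
    finally show False using det by simp
  qed
  ultimately show ?thesis using fullI[OF K x z] by simp
qed

text \<open>Once \<open>x\<close> in \<open>K\<close> has a nontrivial shift, every \<open>y\<close>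
  in \<open>K\<close> must have determinant zero with \<open>x\<close>, which is the linear
  condition with coefficients \<open>- C x\<close> and \<open>S x\<close>. Without such an
  \<open>x\<close>, all of \<open>K\<close> is shiftless.\<close>

lemma not_full_imp_line:
  assumes K: "subgroup K G" and "\<not> full K"
  shows "\<exists>\<alpha> \<beta>. (\<not> int p dvd \<alpha> \<or> \<not> int p dvd \<beta>) \<and> K \<subseteq> line \<alpha> \<beta>"
proof (cases "\<exists>x\<in>K. C x \<noteq> 0")
  case False
  then have "K \<subseteq> line 0 1" using subgroup.subset[OF K] by (auto simp: line_0_1)
  then show ?thesis by (intro exI[of _ 0] exI[of _ 1]) (use p_gt_1 in auto)
next
  case True
  then obtain x where x: "x \<in> K" "C x \<noteq> 0" by auto
  have "\<not> int p dvd - C x"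
    using x subgroup.mem_carrier[OF K] C_range[of x] not_dvd_small[of "C x" p] by auto
  moreover have "K \<subseteq> line (- C x) (S x)"
  proof
    fix y assume y: "y \<in> K"
    have "int p dvd S x * C y - S y * C x"
      using full_of_det[OF K x y] assms(2) by blast
    then show "y \<in> line (- C x) (S x)"
      using y subgroup.mem_carrier[OF K] by (simp add: line_def algebra_simps)
  qed
  ultimately show ?thesis by blast
qed

lemma line_proper:
  assumes "\<not> int p dvd \<alpha> \<or> \<not> int p dvd \<beta>"
  shows "line \<alpha> \<beta> \<noteq> carrier G"
proof -
  have "S sh = 0" "S (dl 0) = 1" using S_dl by (simp_all add: S_def sh moment_def)
  then have "sh \<in> line \<alpha> \<beta> \<Longrightarrow> int p dvd \<beta>" "dl 0 \<in> line \<alpha> \<beta> \<Longrightarrow> int p dvd \<alpha>"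
    by (simp_all add: line_def sh dl)
  then show ?thesis using sh(1) dl(1)[of 0] assms by blast
qed

lemma irredundant_generating_length_le:
  assumes irr: "irredundant_seq G xs" and gen: "generate G (set xs) = carrier G"
  shows "length xs \<le> 3"
proof (rule ccontr)
  assume "\<not> length xs \<le> 3"
  then have len: "length xs \<ge> 4" by simp
  let ?n = "length xs"
  have xc: "set xs \<subseteq> carrier G" using irr by (simp add: irredundant_seq_def)
  have gsub: "subgroup (generate G ((!) xs ` I)) G" if "I \<subseteq> {..<?n}" for I
    using that xc by (intro generate_is_subgroup) (auto simp: subset_iff)
  have contra: "generate G ((!) xs ` I) \<noteq> carrier G" if I: "I \<subseteq> {..<?n}" "card I \<le> 3" for I
  proof
    assume *: "generate G ((!) xs ` I) = carrier G"
    have "finite I" using I finite_subset by blast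
    have "\<not> {..<?n} \<subseteq> I"
      using card_mono[OF \<open>finite I\<close>, of "{..<?n}"] I len by auto
    then obtain m where m: "m < ?n" "m \<notin> I" by auto
    have "generate G ((!) xs ` I) \<subseteq> generate G ((!) xs ` ({..<?n} - {m}))"
      using I m by (intro mono_generate) auto
    moreover have "generate G ((!) xs ` ({..<?n} - {m})) \<subset> generate G (set xs)"
      using irr m by (simp add: irredundant_seq_def)
    ultimately show False using * gen by blast
  qed
  have not_in: "\<exists>j<?n. xs ! j \<notin> K" if "subgroup K G" "K \<noteq> carrier G" for K
  proof (rule ccontr)
    assume "\<not> ?thesis"
    then have "set xs \<subseteq> K" by (auto simp: in_set_conv_nth)
    then have "carrier G \<subseteq> K" using generate_subgroup_incl[OF _ that(1)] gen by blast
    then show False using that subgroup.subset[OF that(1)] by blast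
  qed
  have "line 0 1 \<noteq> carrier G" using line_proper[of 0 1] by (simp del: of_nat_dvd_iff)
  then obtain j where j: "j < ?n" "xs ! j \<notin> line 0 1" using not_in line_subgroup by blast
  let ?x = "xs ! j"
  have "?x \<in> carrier G" using j xc nth_mem by blast
  then have x: "?x \<in> carrier G" "C ?x \<noteq> 0" using j by (auto simp: line_0_1)
  have "\<not> int p dvd - C ?x" using C_range[OF x(1)] x(2) not_dvd_small[of "C ?x" p] by auto
  then have "line (- C ?x) (S ?x) \<noteq> carrier G" using line_proper by blast
  then obtain k where k: "k < ?n" "xs ! k \<notin> line (- C ?x) (S ?x)" using not_in line_subgroup by blast
  let ?y = "xs ! k"
  have y: "?y \<in> carrier G" using k xc nth_mem by blast
  have det: "\<not> int p dvd S ?x * C ?y - S ?y * C ?x"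
    using k(2) y by (auto simp: line_def algebra_simps)
  let ?K = "generate G ((!) xs ` {j, k})"
  have K: "subgroup ?K G" using gsub[of "{j,k}"] j k by auto
  have xyK: "?x \<in> ?K" "?y \<in> ?K" by (auto intro: generate.incl)
  have full: "full ?K" using full_of_det[OF K xyK(1) x(2) xyK(2) det] .
  have "card {j, k} \<le> 3" by (simp add: card_insert_if)
  then have "?K \<noteq> carrier G" using contra[of "{j,k}"] j k by auto
  then obtain l where l: "l < ?n" "xs ! l \<notin> ?K" using not_in[OF K] by blast
  let ?z = "xs ! l"
  have z: "?z \<in> carrier G" using l xc by auto
  \<comment> \<open>As \<open>?K\<close> covers G modulo \<open>VV\<close>, the new entry differs
    from some \<open>u\<close> in \<open>?K\<close> by a translation, nontrivial since the entry is
    not in \<open>?K\<close>.\<close>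
  obtain u where u: "u \<in> ?K" "A ?z = A u" "C ?z = C u"
    using full z unfolding full_def by metis
  have uc: "u \<in> carrier G" using subgroup.mem_carrier[OF K u(1)] .
  let ?K' = "generate G ((!) xs ` {j, k, l})"
  have KK': "?K \<subseteq> ?K'" by (intro mono_generate) auto
  have K': "subgroup ?K' G" using gsub[of "{j,k,l}"] j k l by auto
  have zK': "?z \<in> ?K'" by (auto intro: generate.incl)
  have "?z \<otimes> inv u \<in> VV" using div_in_VV(1)[OF z uc u(2,3)] .
  moreover have "?z \<otimes> inv u \<in> ?K'"
    using zK' u(1) KK' subgroup.m_closed[OF K'] subgroup.m_inv_closed[OF K'] by blast
  moreover have "?z \<otimes> inv u \<noteq> \<one>"
    using l(2) u(1) z uc inv_equality[of ?z "inv u"] by (metis inv_closed inv_inv)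
  moreover have "full ?K'" using full KK' unfolding full_def by blast
  ultimately have "?K' = carrier G" using full_meets_VV[OF K'] by blast
  moreover have "card {j, k, l} \<le> 3" by (simp add: card_insert_if)
  ultimately show False using contra[of "{j,k,l}"] j k l by auto
qed

lemma max_irredundant_generating: "max_irredundant_generating G = 3"
  unfolding max_irredundant_generating_def
proof (rule Max_eqI)
  let ?M = "{length xs |xs. irredundant_seq G xs \<and> generate G (set xs) = carrier G}"
  have "?M \<subseteq> {..3}" using irredundant_generating_length_le by auto
  then show "finite ?M" using finite_subset by blast
  show "y \<le> 3" if "y \<in> ?M" for y using that irredundant_generating_length_le by auto
  let ?xs = "[ev 0, dl 0, sh]"
  have c: "set ?xs \<subseteq> carrier G" by (simp add: ev dl sh)
  have "irredundant_seq G ?xs"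
  proof (rule irredundant_seqI[OF c])
    fix k assume "k < length ?xs"
    then consider "k = 0" | "k = 1" | "k = 2" by (simp add: less_Suc_eq) linarith
    then show "\<exists>K. subgroup K G \<and> ?xs ! k \<notin> K \<and> (\<forall>j<length ?xs. j \<noteq> k \<longrightarrow> ?xs ! j \<in> K)"
    proof cases
      case 1
      let ?K = "{x \<in> carrier G. V x = (\<lambda>i. 0)}"
      have "subgroup ?K G"
        by (rule finite_subgroupI[OF finite_carrier]) (auto simp: V_one V_mult)
      moreover have "V (ev 0) \<noteq> (\<lambda>i. 0)" by (metis ev(2) single_def zero_neq_one)
      ultimately show ?thesis
        using 1 by (intro exI[of _ ?K]) (auto simp: less_Suc_eq ev dl sh)
    next
      case 2
      let ?K = "{x \<in> carrier G. A x = (\<lambda>i. 0)}"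
      have "subgroup ?K G"
        by (rule finite_subgroupI[OF finite_carrier]) (auto simp: A_one A_mult)
      moreover have "A (dl 0) \<noteq> (\<lambda>i. 0)" by (metis dl(3) single_def zero_neq_one)
      ultimately show ?thesis
        using 2 by (intro exI[of _ ?K]) (auto simp: less_Suc_eq ev dl sh)
    next
      case 3
      then show ?thesis
        by (intro exI[of _ "line 0 1"]) (auto simp: less_Suc_eq line_subgroup line_0_1 ev dl sh)
    qed
  qed
  moreover have "generate G (set ?xs) = carrier G"
  proof (rule full_meets_VV[OF _ _ _ ev_VV ev_neq_one])
    show K: "subgroup (generate G (set ?xs)) G" using generate_is_subgroup[OF c] .
    show "ev 0 \<in> generate G (set ?xs)" by (auto intro: generate.incl)
    show "full (generate G (set ?xs))"
      by (rule fullI[OF K, of sh "dl 0"]) (auto intro: generate.incl simp: sh dl S_dl)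
  qed
  ultimately show "3 \<in> ?M" by (intro CollectI exI[of _ ?xs]) simp
qed

lemma irredundant_length_le:
  assumes irr: "irredundant_seq G xs"
  shows "length xs \<le> 2 * p"
proof (cases "generate G (set xs) = carrier G")
  case True
  then show ?thesis using irredundant_generating_length_le[OF irr] p_ge_3 by simp
next
  case False
  have xc: "set xs \<subseteq> carrier G" using irr by (simp add: irredundant_seq_def)
  have s: "subgroup (generate G (set xs)) G" using generate_is_subgroup[OF xc] .
  have "generate G (set xs) \<subset> carrier G" using False subgroup.subset[OF s] by blast
  then have "Omega (card (generate G (set xs))) < Omega (card (carrier G))"
    using Omega_subgroup_psubset[OF finite_carrier s subgroup_self] by blast
  then show ?thesis using irredundant_seq_length_le[OF finite_carrier irr] Omega_carrier by simp
qed

lemma single_apply: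
  assumes "i < p" "j < p"
  shows "single (int i) r (int j) = (if i = j then r else 0)"
  using assms by (auto simp: single_def)

lemma max_irredundant: "max_irredundant G = 2 * p"
  unfolding max_irredundant_def
proof (rule Max_eqI)
  let ?M = "{length xs |xs. irredundant_seq G xs}"
  have "?M \<subseteq> {..2 * p}" using irredundant_length_le by auto
  then show "finite ?M" using finite_subset by blast
  show "y \<le> 2 * p" if "y \<in> ?M" for y using that irredundant_length_le by auto
  let ?xs = "map (\<lambda>i. ev (int i)) [0..<p] @ map (\<lambda>i. dl (int i)) [0..<p]"
  have nth: "?xs ! k = (if k < p then ev (int k) else dl (int (k - p)))" if "k < 2 * p" for k
    using that by (auto simp: nth_append)
  have "irredundant_seq G ?xs"
  proof (rule irredundant_seqI)
    show "set ?xs \<subseteq> carrier G" by (auto simp: ev dl)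
    fix k assume "k < length ?xs"
    then have k: "k < 2 * p" by simp
    show "\<exists>K. subgroup K G \<and> ?xs ! k \<notin> K \<and> (\<forall>j<length ?xs. j \<noteq> k \<longrightarrow> ?xs ! j \<in> K)"
    proof (cases "k < p")
      case True
      \<comment> \<open>Requiring a trivial shift makes the vanishing of a single coordinate closed
        under products.\<close>
      let ?K = "{x \<in> carrier G. C x = 0 \<and> V x (int k) = 0}"
      have "subgroup ?K G"
        by (rule finite_subgroupI[OF finite_carrier]) (auto simp: V_one V_mult C_one C_mult)
      then show ?thesis
        using True by (intro exI[of _ ?K]) (auto simp: nth ev dl single_apply)
    next
      case False
      let ?K = "{x \<in> carrier G. C x = 0 \<and> A x (int (k - p)) = 0}"
      have "subgroup ?K G"
        by (rule finite_subgroupI[OF finite_carrier]) (auto simp: A_one A_mult C_one C_mult)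
      then show ?thesis
        using False k by (intro exI[of _ ?K]) (auto simp: nth ev dl single_apply simp del: of_nat_diff)
    qed
  qed
  then show "2 * p \<in> ?M" by (intro CollectI exI[of _ ?xs]) simp
qed

section \<open>Maximal subgroups in general position\<close>

text \<open>An element acts on V by the affine map with linear part (\<open>A x\<close>,
  \<open>C x\<close>) and translation \<open>V x\<close>. Congruences replace equations because
  \<open>chi\<close> is multiplicative only modulo q.\<close>

definition stab :: "(int \<Rightarrow> int) \<Rightarrow> 'a set" where
  "stab t = {x \<in> carrier G. \<forall>i. [V x i + chi (A x i) * t (i - C x) = t i] (mod int q)}"

abbreviation reduced :: "(int \<Rightarrow> int) \<Rightarrow> bool" where
  "reduced t \<equiv> periodic p t \<and> (\<forall>i. 0 \<le> t i \<and> t i < int q)"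

lemma stab_subgroup:
  assumes t: "periodic p t"
  shows "subgroup (stab t) G"
proof (rule finite_subgroupI[OF finite_carrier])
  show "\<one> \<in> stab t"
    using chi_0 by (auto simp: stab_def V_one A_one C_one cong_scalar_right[where c=1, simplified] cong_def)
  fix x y assume x: "x \<in> stab t" and y: "y \<in> stab t"
  then have xy: "x \<in> carrier G" "y \<in> carrier G" by (auto simp: stab_def)
  have "[V (x \<otimes> y) i + chi (A (x \<otimes> y) i) * t (i - C (x \<otimes> y)) = t i] (mod int q)" for i
  proof -
    let ?j = "i - C x"
    have tt: "t (i - C (x \<otimes> y)) = t (?j - C y)"
      by (rule periodic_cong[OF t]) (use xy in \<open>simp add: C_mult cong_def mod_simps algebra_simps\<close>)
    have "[chi (A (x \<otimes> y) i) = chi (A x i + A y ?j)] (mod int q)"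
      by (rule chi_cong) (use xy in \<open>simp add: A_mult cong_def\<close>)
    also have "[chi (A x i + A y ?j) = chi (A x i) * chi (A y ?j)] (mod int q)" by (rule chi_add)
    finally have c: "[chi (A (x \<otimes> y) i) = chi (A x i) * chi (A y ?j)] (mod int q)" .
    have v: "[V (x \<otimes> y) i = V x i + chi (A x i) * V y ?j] (mod int q)"
      using xy by (simp add: V_mult cong_def)
    have "[V (x \<otimes> y) i + chi (A (x \<otimes> y) i) * t (i - C (x \<otimes> y)) =
        (V x i + chi (A x i) * V y ?j) + chi (A x i) * chi (A y ?j) * t (?j - C y)] (mod int q)"
      unfolding tt by (intro cong_add cong_mult v c cong_refl)
    also have "(V x i + chi (A x i) * V y ?j) + chi (A x i) * chi (A y ?j) * t (?j - C y) =
        V x i + chi (A x i) * (V y ?j + chi (A y ?j) * t (?j - C y))" by (simp add: algebra_simps)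
    also have "[\<dots> = V x i + chi (A x i) * t ?j] (mod int q)"
      using y by (intro cong_add cong_mult cong_refl) (simp add: stab_def)
    also have "[V x i + chi (A x i) * t ?j = t i] (mod int q)" using x by (simp add: stab_def)
    finally show ?thesis .
  qed
  then show "x \<otimes> y \<in> stab t" using xy by (simp add: stab_def)
qed (auto simp: stab_def)

text \<open>Translations act freely. With \<open>stab_full\<close> this makes \<open>stab t\<close>
  a complement of \<open>VV\<close>.\<close>

lemma stab_VV:
  assumes "x \<in> stab t" "x \<in> VV"
  shows "x = \<one>"
proof (rule coordinates_inject)
  have x: "x \<in> carrier G" "A x = (\<lambda>i. 0)" "C x = 0" using assms by (auto simp: VV_def)
  show "V x = V \<one>"
  proof
    fix i
    have "[V x i + chi 0 * t i = t i] (mod int q)"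
      using assms(1) x unfolding stab_def mem_Collect_eq by (metis diff_zero)
    then have "[V x i + t i = t i] (mod int q)" by (simp add: cong_def)
    then have "int q dvd V x i" by (simp add: cong_iff_dvd_diff)
    then show "V x i = V \<one> i" using V_mod[OF x(1), of i] by (simp add: V_one)
  qed
qed (use assms in \<open>auto simp: VV_def A_one C_one\<close>)

lemma stab_full:
  assumes t: "periodic p t"
  shows "full (stab t)"
  unfolding full_def
proof
  fix y assume y: "y \<in> carrier G"
  let ?v = "\<lambda>i. t i - chi (A y i) * t (i - C y)"
  have "periodic p ?v" using t A_periodic[OF y] periodic_shift[OF t, of "C y"] by (simp add: periodic_def)
  note m = mk[OF this A_periodic[OF y], of "C y"]
  let ?x = "mk ?v (A y) (C y)"
  have "?x \<in> stab t"
    using m y by (simp add: stab_def cong_def mod_simps)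
  moreover have "A ?x = A y" "C ?x = C y" using m y by auto
  ultimately show "\<exists>x\<in>stab t. A x = A y \<and> C x = C y" by blast
qed

lemma stab_proper: "periodic p t \<Longrightarrow> stab t \<noteq> carrier G"
  using stab_VV[OF _ ev_VV] ev_neq_one ev(1) by metis

lemma stab_eqI:
  assumes t: "periodic p t" and x: "x \<in> stab t" and y: "y \<in> stab t" and "A x = A y" "C x = C y"
  shows "x = y"
proof -
  have c: "x \<in> carrier G" "y \<in> carrier G" using x y by (auto simp: stab_def)
  have "x \<otimes> inv y \<in> stab t"
    using x y subgroup.m_closed[OF stab_subgroup[OF t]] subgroup.m_inv_closed[OF stab_subgroup[OF t]] by blast
  then have "x \<otimes> inv y = \<one>"
    using stab_VV div_in_VV(1)[OF c assms(4,5)] by blast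
  then show ?thesis using c inv_equality[of x "inv y"] by (metis inv_closed inv_inv)
qed

text \<open>A strictly larger subgroup contains two different elements with equal linear part, hence
  a nontrivial translation, and it still covers the quotient by \<open>VV\<close>.\<close>

lemma stab_maximal:
  assumes t: "periodic p t"
  shows "maximal_subgroup (stab t) G"
  unfolding maximal_subgroup_def
proof (intro conjI allI impI)
  fix K assume "subgroup K G \<and> stab t \<subseteq> K"
  then have K: "subgroup K G" and sub: "stab t \<subseteq> K" by auto
  show "K = stab t \<or> K = carrier G"
  proof (rule ccontr)
    assume *: "\<not> ?thesis"
    then obtain y where y: "y \<in> K" "y \<notin> stab t" using sub by blast
    have yc: "y \<in> carrier G" using subgroup.mem_carrier[OF K y(1)] .
    obtain x where x: "x \<in> stab t" "A y = A x" "C y = C x"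
      using stab_full[OF t] yc unfolding full_def by metis
    have xc: "x \<in> carrier G" using x by (simp add: stab_def)
    have "y \<otimes> inv x \<in> VV" using div_in_VV(1)[OF yc xc x(2,3)] .
    moreover have "y \<otimes> inv x \<in> K"
      using x y sub by (auto intro: subgroup.m_closed[OF K] subgroup.m_inv_closed[OF K])
    moreover have "y \<otimes> inv x \<noteq> \<one>"
      using x y yc xc inv_equality[of y "inv x"] by (metis inv_closed inv_inv)
    moreover have "full K" using stab_full[OF t] sub unfolding full_def by blast
    ultimately show False using full_meets_VV[OF K] * by blast
  qed
qed (use stab_subgroup[OF t] stab_proper[OF t] in auto)

text \<open>A complement of \<open>VV\<close> contains a lift \<open>z\<close> of the central scalar \<open>chi 1\<close>, and \<open>z\<close> is central in the complement.
  Hence the complement fixes the unique fixed point of \<open>z\<close>.\<close>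

lemma full_proper_imp_stab:
  assumes M: "subgroup M G" and full: "full M" and proper: "M \<noteq> carrier G"
  shows "\<exists>t. reduced t \<and> M \<subseteq> stab t"
proof -
  have Mc: "x \<in> carrier G" if "x \<in> M" for x by (rule subgroup.mem_carrier[OF M that])
  obtain z where z: "z \<in> M" "\<And>i. A z i = 1 mod int p" "C z = 0 mod int p"
    using fullD[OF full periodic_const] by metis
  have zc: "z \<in> carrier G" "A z = (\<lambda>i. 1)" "C z = 0" using z Mc by auto
  have "\<not> int q dvd 1 - chi 1" using chi_1 by (simp add: cong_iff_dvd_diff dvd_diff_commute)
  then obtain n where n: "[int n * (1 - chi 1) = 1] (mod int q)" using prime_modulus_coefficient prime_q by metis
  \<comment> \<open>The fixed point of \<open>z\<close> solves V z + chi 1 * t = t, and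
    \<open>n\<close> inverts \<open>1 - chi 1\<close> modulo q.\<close>
  define t where "t i = (int n * V z i) mod int q" for i
  have "reduced t" using V_periodic[OF zc(1)] by (auto simp: t_def periodic_def)
  moreover have "M \<subseteq> stab t"
  proof
    fix m assume m: "m \<in> M"
    then have mc: "m \<in> carrier G" using Mc by blast
    have AC: "A (z \<otimes> m) = A (m \<otimes> z)" "C (z \<otimes> m) = C (m \<otimes> z)"
      using zc mc by (auto simp: A_mult C_mult add.commute)
    have zm: "z \<otimes> m \<in> carrier G" "m \<otimes> z \<in> carrier G" using zc mc by auto
    \<comment> \<open>A scalar commutes with every monomial matrix, so the commutator of
      \<open>z\<close> and \<open>m\<close> is a translation in \<open>M\<close>; it is trivial
      because \<open>M\<close> is proper.\<close>
    have "(z \<otimes> m) \<otimes> inv (m \<otimes> z) \<in> VV" using div_in_VV(1)[OF zm AC] .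
    moreover have "(z \<otimes> m) \<otimes> inv (m \<otimes> z) \<in> M"
      using z(1) m by (intro subgroup.m_closed[OF M] subgroup.m_inv_closed[OF M])
    ultimately have "(z \<otimes> m) \<otimes> inv (m \<otimes> z) = \<one>"
      using full_meets_VV[OF M full] proper by blast
    then have "z \<otimes> m = m \<otimes> z" using zm inv_equality[of "z \<otimes> m" "inv (m \<otimes> z)"] by (metis inv_closed inv_inv)
    have "[V m i + chi (A m i) * t (i - C m) = t i] (mod int q)" for i
    proof -
      let ?c = "chi (A m i)" and ?w = "V z (i - C m)"
      have "[V z i + chi 1 * V m i = V m i + ?c * ?w] (mod int q)"
        using V_mult[OF zc(1) mc, of i] V_mult[OF mc zc(1), of i] \<open>z \<otimes> m = m \<otimes> z\<close> zc
        by (simp add: cong_def)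
      then have "[V m i - chi 1 * V m i = V z i - ?c * ?w] (mod int q)"
        by (simp add: cong_iff_dvd_diff algebra_simps dvd_diff_commute)
      then have "[int n * (V m i - chi 1 * V m i) = int n * (V z i - ?c * ?w)] (mod int q)"
        by (rule cong_scalar_left)
      moreover have "[int n * (1 - chi 1) * V m i = 1 * V m i] (mod int q)"
        using n by (rule cong_scalar_right)
      ultimately have "[V m i = int n * (V z i - ?c * ?w)] (mod int q)"
        by (simp add: algebra_simps) (metis cong_sym cong_trans)
      then have e: "[V m i + ?c * (int n * ?w) = int n * (V z i - ?c * ?w) + ?c * (int n * ?w)] (mod int q)"
        by (intro cong_add cong_refl)
      have "[V m i + ?c * t (i - C m) = V m i + ?c * (int n * ?w)] (mod int q)"
        by (intro cong_add cong_mult cong_refl) (simp add: t_def cong_def)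
      also note e
      also have "int n * (V z i - ?c * ?w) + ?c * (int n * ?w) = int n * V z i" by (simp add: algebra_simps)
      also have "[int n * V z i = t i] (mod int q)" by (simp add: t_def cong_def)
      finally show ?thesis .
    qed
    then show "m \<in> stab t" using mc by (simp add: stab_def)
  qed
  ultimately show ?thesis by blast
qed

lemma maximal_subgroup_cases:
  assumes M: "maximal_subgroup M G"
  obtains (line) \<alpha> \<beta> where "\<not> int p dvd \<alpha> \<or> \<not> int p dvd \<beta>" "M = line \<alpha> \<beta>"
    | (stab) t where "reduced t" "M = stab t"
proof -
  have M': "subgroup M G" "M \<noteq> carrier G" "\<And>K. subgroup K G \<Longrightarrow> M \<subseteq> K \<Longrightarrow> K = M \<or> K = carrier G"
    using M by (simp_all add: maximal_subgroup_def)
  show ?thesis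
  proof (cases "full M")
    case True
    then obtain t where t: "reduced t" "M \<subseteq> stab t"
      using full_proper_imp_stab[OF M'(1)] M'(2) by blast
    then have "stab t = M"
      using M'(3)[of "stab t"] stab_subgroup[of t] stab_proper[of t] by simp
    then show ?thesis using t stab by blast
  next
    case False
    then obtain \<alpha> \<beta> where ab: "\<not> int p dvd \<alpha> \<or> \<not> int p dvd \<beta>" "M \<subseteq> line \<alpha> \<beta>"
      using not_full_imp_line[OF M'(1)] by blast
    then have "line \<alpha> \<beta> = M"
      using M'(3)[OF line_subgroup] line_proper[OF ab(1)] by blast
    then show ?thesis using ab line by blast
  qed
qed

section \<open>Orders of stabilizers and of their intersections\<close>

lemma card_stab:
  assumes t: "periodic p t"
  shows "card (stab t) = p ^ (p + 1)"
proof -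
  let ?R = "{f. periodic p f \<and> (\<forall>i. 0 \<le> f i \<and> f i < int p)}"
  have bij: "bij_betw (\<lambda>x. (A x, C x)) (stab t) (?R \<times> {0..<int p})"
    unfolding bij_betw_def
  proof
    show "inj_on (\<lambda>x. (A x, C x)) (stab t)"
      by (rule inj_onI) (auto intro: stab_eqI[OF t])
    show "(\<lambda>x. (A x, C x)) ` stab t = ?R \<times> {0..<int p}"
    proof (intro equalityI subsetI)
      fix u assume u: "u \<in> ?R \<times> {0..<int p}"
      obtain a c where ac: "u = (a, c)" by (cases u)
      with u have *: "periodic p a" "c mod int p = c" "\<And>i. a i mod int p = a i" by auto
      obtain x where "x \<in> stab t" "\<And>i. A x i = a i mod int p" "C x = c mod int p"
        using fullD[OF stab_full[OF t] *(1)] by blast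
      then show "u \<in> (\<lambda>x. (A x, C x)) ` stab t" using * ac by (auto intro!: image_eqI[of _ _ x])
    qed (auto simp: stab_def A_periodic A_range C_range)
  qed
  show ?thesis
    using bij_betw_same_card[OF bij] by (simp add: card_cartesian_product card_reduced_periodic)
qed

text \<open>Subtracting the two fixed-point equations cancels the translation part: the linear part
  of \<open>x\<close> fixes the vector t - u.\<close>

lemma stab_both:
  assumes "x \<in> stab t" "x \<in> stab u"
  shows "[chi (A x i) * (t (i - C x) - u (i - C x)) = t i - u i] (mod int q)"
proof -
  have "[V x i + chi (A x i) * t (i - C x) = t i] (mod int q)"
    "[V x i + chi (A x i) * u (i - C x) = u i] (mod int q)" using assms by (auto simp: stab_def)
  then have "[(V x i + chi (A x i) * t (i - C x)) - (V x i + chi (A x i) * u (i - C x)) = t i - u i] (mod int q)"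
    by (rule cong_diff)
  then show ?thesis by (simp add: algebra_simps)
qed

lemma reduced_cong_imp_eq:
  assumes "reduced t" "reduced u" "[t i = u i] (mod int q)"
  shows "t i = u i"
  using assms by (metis cong_def mod_pos_pos_trivial)

lemma stab_both_A:
  assumes t: "reduced t" and u: "reduced u" and x: "x \<in> stab t" "x \<in> stab u" "C x = 0" and i: "t i \<noteq> u i"
  shows "A x i = 0"
proof -
  have xc: "x \<in> carrier G" using x by (simp add: stab_def)
  have "[chi (A x i) * (t i - u i) = t i - u i] (mod int q)" using stab_both[OF x(1,2), of i] x(3) by simp
  then have "int q dvd (chi (A x i) - 1) * (t i - u i)" by (simp add: cong_iff_dvd_diff algebra_simps)
  moreover have "\<not> int q dvd t i - u i"
    using reduced_cong_imp_eq[OF t u, of i] i by (auto simp: cong_iff_dvd_diff)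
  ultimately have "int q dvd chi (A x i) - 1" using prime_q prime_dvd_mult_iff[of "int q"] by auto
  then have "int p dvd A x i" using chi_eq_1_iff by (simp add: cong_iff_dvd_diff)
  then show ?thesis using A_mod[OF xc, of i] by simp
qed

text \<open>The linear part fixes t - u, so the zero set of t - u is invariant under the shift by
  \<open>C x\<close>. A nonzero shift is transitive on Z/p, so it would leave only the empty and the
  full zero set.\<close>

lemma stab_both_C:
  assumes t: "reduced t" and u: "reduced u" and x: "x \<in> stab t" "x \<in> stab u"
    and i: "t i \<noteq> u i" and k: "t k = u k"
  shows "C x = 0"
proof (rule ccontr)
  have xc: "x \<in> carrier G" using x by (simp add: stab_def)
  assume "C x \<noteq> 0"
  then have "\<not> int p dvd C x" using C_range[OF xc] not_dvd_small by blast
  then obtain m where m: "[int m * C x = i - k] (mod int p)" using prime_modulus_coefficient prime_p by metis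
  have "t (k + int m * C x) = u (k + int m * C x)" for m
  proof (induction m)
    case (Suc m)
    have "k + int (Suc m) * C x - C x = k + int m * C x" by (simp add: algebra_simps)
    then have "[0 = t (k + int (Suc m) * C x) - u (k + int (Suc m) * C x)] (mod int q)"
      using stab_both[OF x, of "k + int (Suc m) * C x"] Suc by (simp only: diff_self mult_zero_right)
    then have "[t (k + int (Suc m) * C x) = u (k + int (Suc m) * C x)] (mod int q)"
      by (simp add: cong_iff_dvd_diff dvd_diff_commute)
    then show ?case using reduced_cong_imp_eq[OF t u] by blast
  qed (use k in simp)
  moreover have "[k + int m * C x = i] (mod int p)"
    using m by (simp add: cong_iff_dvd_diff algebra_simps)
  ultimately show False
    using i t u periodic_cong by metis
qed

text \<open>The order is a power of p, so it suffices to bound it by p^(p-2). If t - u has no zero,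
  a shiftless common stabilizer element is trivial, so \<open>C\<close> is injective and the order
  is at most p, which is enough as p >= 3. If t - u has a zero, there are no shifts and the
  exponents vanish at the two or more places where the points differ.\<close>

lemma Omega_stab_both:
  assumes t: "reduced t" and u: "reduced u"
    and D: "card {i \<in> {0..<int p}. t i \<noteq> u i} \<ge> 2"
  shows "Omega (card (stab t \<inter> stab u)) \<le> p - 2"
proof -
  let ?E = "stab t \<inter> stab u" and ?D = "{i \<in> {0..<int p}. t i \<noteq> u i}"
  have pt: "periodic p t" and pu: "periodic p u" using t u by auto
  have E: "subgroup ?E G" using stab_subgroup pt pu subgroups_Inter_pair by blast
  have "card ?E dvd p ^ (p + 1)"
    using card_subgroup_dvd[OF E stab_subgroup[OF pt]] card_stab[OF pt] by simp
  then obtain k where k: "card ?E = p ^ k" using divides_primepow_nat[OF prime_p] by blast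
  have "card ?E \<le> p ^ (p - 2)"
  proof (cases "\<exists>k. t k = u k")
    case False
    have "inj_on C ?E"
    proof (rule inj_onI)
      fix x y assume x: "x \<in> ?E" and y: "y \<in> ?E" and C: "C x = C y"
      have c: "x \<in> carrier G" "y \<in> carrier G" using x y by (auto simp: stab_def)
      let ?z = "x \<otimes> inv y"
      have z: "?z \<in> ?E" using x y subgroup.m_closed[OF E] subgroup.m_inv_closed[OF E] by blast
      have "C ?z = 0" using C c by (simp add: C_div)
      moreover have "A ?z i = 0" for i
        using stab_both_A[OF t u _ _ \<open>C ?z = 0\<close>, of i] z False by blast
      ultimately have "?z \<in> VV" using c by (auto simp: VV_def)
      then have "?z = \<one>" using stab_VV z by blast
      then show "x = y" using c inv_equality[of x "inv y"] by (metis inv_closed inv_inv)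
    qed
    moreover have "C ` ?E \<subseteq> {0..<int p}" using C_range by (auto simp: stab_def)
    ultimately have "card ?E \<le> card {0..<int p}" by (intro card_inj_on_le) auto
    also have "\<dots> = p ^ 1" by simp
    also have "\<dots> \<le> p ^ (p - 2)" using p_ge_3 by (intro power_increasing) auto
    finally show ?thesis .
  next
    case True
    then obtain k where k: "t k = u k" by blast
    have "?D \<noteq> {}" using D by (metis card.empty not_numeral_le_zero)
    then obtain i where i: "t i \<noteq> u i" by blast
    have C0: "C x = 0" if "x \<in> ?E" for x using stab_both_C[OF t u _ _ i k] that by blast
    have A0: "A x j = 0" if "x \<in> ?E" "t j \<noteq> u j" for x j
      using stab_both_A[OF t u _ _ C0] that by blast
    let ?F = "{0..<int p} - ?D"
    let ?P = "PiE ?F (\<lambda>_. {0..<int p})"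
    have "inj_on (\<lambda>x. restrict (A x) ?F) ?E"
    proof (rule inj_onI)
      fix x y assume x: "x \<in> ?E" and y: "y \<in> ?E" and e: "restrict (A x) ?F = restrict (A y) ?F"
      have c: "x \<in> carrier G" "y \<in> carrier G" using x y by (auto simp: stab_def)
      have "A x = A y"
      proof (rule periodic_eqI)
        fix j assume j: "0 \<le> j" "j < int p"
        show "A x j = A y j"
        proof (cases "t j = u j")
          case True
          then show ?thesis using fun_cong[OF e, of j] j by simp
        qed (use A0 x y in simp)
      qed (use c A_periodic in auto)
      then show "x = y" using stab_eqI[OF pt] x y C0 by auto
    qed
    moreover have "(\<lambda>x. restrict (A x) ?F) ` ?E \<subseteq> ?P"
      using A_range by (auto simp: stab_def)
    moreover have "finite ?P" by (intro finite_PiE) auto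
    ultimately have "card ?E \<le> card ?P" by (rule card_inj_on_le)
    also have "\<dots> = p ^ card ?F" by (simp add: card_PiE)
    also have "\<dots> \<le> p ^ (p - 2)"
    proof (rule power_increasing)
      have "finite ?D" by (rule finite_subset[of _ "{0..<int p}"]) auto
      then have "card ?F = card {0..<int p} - card ?D" by (rule card_Diff_subset) auto
      then show "card ?F \<le> p - 2" using D by simp
      show "1 \<le> p" using p_pos by linarith
    qed
    finally show ?thesis .
  qed
  then have "k \<le> p - 2" using k power_le_imp_le_exp[of p k "p - 2"] by simp
  then show ?thesis using k Omega_prime_power prime_p by simp
qed

text \<open>The forms are proportional: \<open>\<alpha>\<close> times or \<open>\<beta>\<close>
  times the second is a multiple of the first modulo p, and one of these factors is
  invertible.\<close>

lemma line_subset_line: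
  assumes "\<not> int p dvd \<alpha> \<or> \<not> int p dvd \<beta>" and det: "int p dvd \<alpha> * \<beta>' - \<alpha>' * \<beta>"
  shows "line \<alpha> \<beta> \<subseteq> line \<alpha>' \<beta>'"
proof
  fix x assume x: "x \<in> line \<alpha> \<beta>"
  let ?e = "\<alpha>' * S x + \<beta>' * C x"
  have d: "int p dvd \<alpha> * S x + \<beta> * C x" using x by (simp add: line_def)
  have "\<alpha> * ?e = \<alpha>' * (\<alpha> * S x + \<beta> * C x) + C x * (\<alpha> * \<beta>' - \<alpha>' * \<beta>)"
    "\<beta> * ?e = \<beta>' * (\<alpha> * S x + \<beta> * C x) - S x * (\<alpha> * \<beta>' - \<alpha>' * \<beta>)" by (simp_all add: algebra_simps)
  then have "int p dvd \<alpha> * ?e" "int p dvd \<beta> * ?e"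
    using d det by (metis dvd_add dvd_mult, metis dvd_diff dvd_mult)
  then have "int p dvd ?e" using assms(1) prime_dvd_mult_iff[OF prime_int_p] by blast
  then show "x \<in> line \<alpha>' \<beta>'" using x by (simp add: line_def)
qed

text \<open>Cramer's rule: two independent forms in two variables have only the trivial common
  zero.\<close>

lemma common_nonzero_imp_det:
  assumes "\<not> int p dvd s \<or> \<not> int p dvd c"
    and 1: "int p dvd \<alpha> * s + \<beta> * c" and 2: "int p dvd \<alpha>' * s + \<beta>' * c"
  shows "int p dvd \<alpha> * \<beta>' - \<alpha>' * \<beta>"
proof -
  let ?d = "\<alpha> * \<beta>' - \<alpha>' * \<beta>"
  have "s * ?d = \<beta>' * (\<alpha> * s + \<beta> * c) - \<beta> * (\<alpha>' * s + \<beta>' * c)"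
    "c * ?d = \<alpha> * (\<alpha>' * s + \<beta>' * c) - \<alpha>' * (\<alpha> * s + \<beta> * c)" by (simp_all add: algebra_simps)
  then have "int p dvd s * ?d" "int p dvd c * ?d" using 1 2 by (metis dvd_diff dvd_mult)+
  then show ?thesis using assms(1) prime_dvd_mult_iff[OF prime_int_p] by blast
qed

lemma differ_once:
  assumes t: "periodic p t" and u: "periodic p u" and "t \<noteq> u" and "card {i \<in> {0..<int p}. t i \<noteq> u i} < 2"
  obtains k where "k \<in> {0..<int p}" "\<And>i. i \<in> {0..<int p} \<Longrightarrow> t i = u i \<longleftrightarrow> i \<noteq> k"
proof -
  let ?D = "{i \<in> {0..<int p}. t i \<noteq> u i}"
  have "?D \<noteq> {}" using periodic_eqI[OF t u p_pos] \<open>t \<noteq> u\<close> by auto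
  moreover have "finite ?D" by (rule finite_subset[of _ "{0..<int p}"]) auto
  ultimately have "card ?D > 0" using card_gt_0_iff by blast
  then have "card ?D = 1" using assms(4) by linarith
  then obtain k where "?D = {k}" by (auto simp: card_1_singleton_iff)
  then have "k \<in> {0..<int p}" "\<And>i. i \<in> {0..<int p} \<Longrightarrow> t i = u i \<longleftrightarrow> i \<noteq> k" by blast+
  then show ?thesis using that by blast
qed

lemma other_index:
  obtains j where "j \<in> {0..<int p}" "j \<noteq> k"
proof (cases "k = 0")
  case True
  then show ?thesis using that[of 1] p_gt_1 by simp
next
  case False
  then show ?thesis using that[of 0] by simp
qed

lemma general_position_maximal_le:
  assumes max: "\<And>k. k < n \<Longrightarrow> maximal_subgroup (H k) G" and gp: "general_position G {..<n} H"
  shows "n \<le> p"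
proof (rule ccontr)
  assume "\<not> n \<le> p"
  then have np: "n > p" by simp
  have wit: "\<exists>g\<in>carrier G. g \<notin> H k \<and> (\<forall>j<n. j \<noteq> k \<longrightarrow> g \<in> H j)" if "k < n" for k
    using general_position_witness[OF gp, of k] that by (metis lessThan_iff)
  define L where "L = {k. k < n \<and> (\<exists>\<alpha> \<beta>. (\<not> int p dvd \<alpha> \<or> \<not> int p dvd \<beta>) \<and> H k = line \<alpha> \<beta>)}"
  define T where "T = {k. k < n \<and> (\<exists>t. reduced t \<and> H k = stab t)}"
  have fin: "finite L" "finite T" by (auto simp: L_def T_def)
  have "{..<n} \<subseteq> L \<union> T"
  proof
    fix k assume "k \<in> {..<n}"
    then have k: "k < n" by simp
    show "k \<in> L \<union> T"
      by (rule maximal_subgroup_cases[OF max[OF k]]) (use k in \<open>unfold L_def T_def, blast+\<close>)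
  qed
  then have "n \<le> card (L \<union> T)" using card_mono[of "L \<union> T" "{..<n}"] fin by simp
  then have nLT: "n \<le> card L + card T" using card_Un_le[of L T] by simp
  have "\<forall>k\<in>T. \<exists>t. reduced t \<and> H k = stab t" by (auto simp: T_def)
  then obtain \<tau> where \<tau>: "\<And>k. k \<in> T \<Longrightarrow> reduced (\<tau> k)" "\<And>k. k \<in> T \<Longrightarrow> H k = stab (\<tau> k)"
    using bchoice[of T] by metis
  have Tn: "k < n" if "k \<in> T" for k using that by (simp add: T_def)
  have Ln: "k < n" if "k \<in> L" for k using that by (simp add: L_def)
  \<comment> \<open>Two points differing in two coordinates would leave room for only p - 2 further
    members, against n > p.\<close>
  have small: "card {i \<in> {0..<int p}. \<tau> a i \<noteq> \<tau> b i} < 2" if ab: "a \<in> T" "b \<in> T" "a \<noteq> b" for a b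
  proof (rule ccontr)
    assume "\<not> ?thesis"
    then have "Omega (card (stab (\<tau> a) \<inter> stab (\<tau> b))) \<le> p - 2"
      using Omega_stab_both \<tau>(1) ab by simp
    moreover have "carrier G \<inter> (\<Inter>j\<in>{a, b}. H j) = stab (\<tau> a) \<inter> stab (\<tau> b)"
      using ab \<tau>(2) by (auto simp: stab_def)
    moreover have "card ({..<n} - {a, b}) \<le> Omega (card (carrier G \<inter> (\<Inter>j\<in>{a, b}. H j)))"
      using ab Tn by (intro general_position_card_le[OF finite_carrier gp]) auto
    moreover have "card ({..<n} - {a, b}) = n - 2"
      using ab Tn by (simp add: card_Diff_subset)
    ultimately show False using np p_ge_3 by simp
  qed
  have diff: "\<exists>k\<in>{0..<int p}. \<forall>i\<in>{0..<int p}. \<tau> a i = \<tau> b i \<longleftrightarrow> i \<noteq> k"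
    if ab: "a \<in> T" "b \<in> T" "a \<noteq> b" for a b
  proof -
    have "H a \<noteq> H b" using wit[OF Tn[OF ab(1)]] Tn[OF ab(2)] ab by metis
    then have "\<tau> a \<noteq> \<tau> b" using \<tau>(2) ab by metis
    then show ?thesis using differ_once[OF _ _ _ small[OF ab]] \<tau>(1) ab by metis
  qed
  \<comment> \<open>The two points differ at k and agree at any other index, so
    \<open>stab_both_C\<close> excludes shifts.\<close>
  have C0: "C x = 0" if ab: "a \<in> T" "b \<in> T" "a \<noteq> b" and x: "x \<in> H a" "x \<in> H b" for a b x
  proof -
    obtain k where k: "k \<in> {0..<int p}" "\<forall>i\<in>{0..<int p}. \<tau> a i = \<tau> b i \<longleftrightarrow> i \<noteq> k"
      using diff[OF ab] by blast
    obtain j where j: "j \<in> {0..<int p}" "j \<noteq> k" using other_index .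
    show ?thesis
      using stab_both_C[OF \<tau>(1)[OF ab(1)] \<tau>(1)[OF ab(2)], of x k j] x k j \<tau>(2) ab by blast
  qed
  have T2: "card T \<le> 2"
  proof (rule ccontr)
    assume "\<not> card T \<le> 2"
    then have "card T \<ge> 3" by simp
    then obtain a b c where abc: "a \<in> T" "b \<in> T" "c \<in> T" "a \<noteq> b" "a \<noteq> c" "b \<noteq> c"
      by (rule card_ge_3E)
    obtain k where k: "k \<in> {0..<int p}" "\<forall>i\<in>{0..<int p}. \<tau> a i = \<tau> b i \<longleftrightarrow> i \<noteq> k"
      using diff[OF abc(1,2,4)] by blast
    obtain l where l: "l \<in> {0..<int p}" "\<forall>i\<in>{0..<int p}. \<tau> a i = \<tau> c i \<longleftrightarrow> i \<noteq> l"
      using diff[OF abc(1,3,5)] by blast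
    obtain m where m: "m \<in> {0..<int p}" "\<forall>i\<in>{0..<int p}. \<tau> b i = \<tau> c i \<longleftrightarrow> i \<noteq> m"
      using diff[OF abc(2,3,6)] by blast
    \<comment> \<open>Otherwise the second and third point would differ at both k and l. So all
      three points differ only in one common coordinate.\<close>
    have "k = l" using k l m by metis
    obtain g where g: "g \<in> carrier G" "g \<notin> H c" "\<forall>j<n. j \<noteq> c \<longrightarrow> g \<in> H j"
      using wit[OF Tn[OF abc(3)]] by blast
    have ga: "g \<in> stab (\<tau> a)" and gb: "g \<in> stab (\<tau> b)" using g \<tau>(2) abc Tn by metis+
    have Cg: "C g = 0" using C0[OF abc(1,2,4)] ga gb \<tau>(2) abc by blast
    have "A g k = 0"
      using stab_both_A[OF \<tau>(1)[OF abc(1)] \<tau>(1)[OF abc(2)] ga gb Cg, of k] k by blast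
    \<comment> \<open>Fixing two points that differ at k forces trivial exponent and zero
      translation there. Hence \<open>g\<close> fixes every point that agrees with them off k, in
      particular the third, against its choice.\<close>
    have red: "[V g i + chi (A g i) * \<tau> c i = \<tau> c i] (mod int q)" if i: "i \<in> {0..<int p}" for i
    proof -
      have *: "[V g i + chi (A g i) * \<tau> a i = \<tau> a i] (mod int q)" using ga Cg by (simp add: stab_def)
      show ?thesis
      proof (cases "i = k")
        case True
        then have "[V g i + \<tau> a i = \<tau> a i] (mod int q)" using * \<open>A g k = 0\<close> by (simp add: cong_def)
        then have "[V g i + \<tau> c i = \<tau> c i] (mod int q)" by (simp add: cong_iff_dvd_diff)
        then show ?thesis using True \<open>A g k = 0\<close> by (simp add: cong_def)
      next
        case False
        then have "\<tau> a i = \<tau> c i" using l(2) i \<open>k = l\<close> by blast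
        then show ?thesis using * by simp
      qed
    qed
    have "g \<in> stab (\<tau> c)"
      unfolding stab_def
    proof (intro CollectI conjI allI)
      fix i
      have "V g (i mod int p) = V g i" "A g (i mod int p) = A g i" "\<tau> c (i mod int p) = \<tau> c i"
        using periodic_mod V_periodic[OF g(1)] A_periodic[OF g(1)] \<tau>(1)[OF abc(3)] by auto
      then show "[V g i + chi (A g i) * \<tau> c (i - C g) = \<tau> c i] (mod int q)"
        using red[of "i mod int p"] Cg by simp
    qed (fact g)
    then show False using g \<tau>(2) abc by blast
  qed
  have L2: "card L \<le> 2"
  proof (rule ccontr)
    assume "\<not> card L \<le> 2"
    then have "card L \<ge> 3" by simp
    then obtain a b c where abc: "a \<in> L" "b \<in> L" "c \<in> L" "a \<noteq> b" "a \<noteq> c" "b \<noteq> c"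
      by (rule card_ge_3E)
    obtain \<alpha> \<beta> where a: "H a = line \<alpha> \<beta>" using abc by (auto simp: L_def)
    obtain \<alpha>1 \<beta>1 where b: "\<not> int p dvd \<alpha>1 \<or> \<not> int p dvd \<beta>1" "H b = line \<alpha>1 \<beta>1"
      using abc unfolding L_def by blast
    obtain \<alpha>2 \<beta>2 where c: "H c = line \<alpha>2 \<beta>2" using abc by (auto simp: L_def)
    obtain g where g: "g \<in> carrier G" "g \<notin> H a" "\<forall>j<n. j \<noteq> a \<longrightarrow> g \<in> H j"
      using wit[OF Ln[OF abc(1)]] by blast
    \<comment> \<open>In the two-dimensional Frattini quotient the witness against
      \<open>H a\<close> is a nonzero common zero of the other two forms, so these are proportional
      and \<open>H b\<close> lies in \<open>H c\<close>.\<close>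
    have "\<not> int p dvd S g \<or> \<not> int p dvd C g"
      using g(1,2) unfolding a line_def by (auto intro: dvd_add)
    moreover have "g \<in> H b" "g \<in> H c" using g abc Ln by metis+
    ultimately have "int p dvd \<alpha>1 * \<beta>2 - \<alpha>2 * \<beta>1"
      unfolding b(2) c by (intro common_nonzero_imp_det[of "S g" "C g"]) (auto simp: line_def)
    then have "H b \<subseteq> H c" unfolding b(2) c by (rule line_subset_line[OF b(1)])
    then show False using wit[OF Ln[OF abc(3)]] abc Ln by blast
  qed
  have "card L \<le> 1" if T: "card T \<ge> 2"
  proof (rule ccontr)
    assume "\<not> card L \<le> 1"
    then have "card L \<ge> 2" by simp
    then obtain a b where ab: "a \<in> L" "b \<in> L" "a \<noteq> b" by (rule card_ge_2E)
    obtain c d where cd: "c \<in> T" "d \<in> T" "c \<noteq> d" using T by (rule card_ge_2E)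
    \<comment> \<open>A witness against a line lies in both point stabilizers and so has no shift;
      only \<open>S\<close> remains to tell lines apart, which leaves room for one line. The first
      case is void, as a proper line contains translations and therefore cannot be full.\<close>
    have C_wit: "\<exists>g\<in>carrier G. g \<notin> H k \<and> (\<forall>j<n. j \<noteq> k \<longrightarrow> g \<in> H j) \<and> C g = 0" if k: "k \<in> L" for k
    proof (cases "k \<in> {c, d}")
      case True
      then have "full (H k)" using stab_full \<tau> cd by auto
      moreover obtain \<alpha> \<beta> where ab: "\<not> int p dvd \<alpha> \<or> \<not> int p dvd \<beta>" "H k = line \<alpha> \<beta>"
        using k unfolding L_def by blast
      ultimately have "full (line \<alpha> \<beta>)" by simp
      moreover have "ev 0 \<in> line \<alpha> \<beta>" by (simp add: line_def ev S_def moment_def)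
      ultimately have "line \<alpha> \<beta> = carrier G"
        using full_meets_VV[OF line_subgroup] ev_VV ev_neq_one by blast
      then show ?thesis using line_proper[OF ab(1)] by blast
    next
      case False
      obtain g where g: "g \<in> carrier G" "g \<notin> H k" "\<forall>j<n. j \<noteq> k \<longrightarrow> g \<in> H j"
        using wit[OF Ln[OF k]] by blast
      then have "C g = 0" using C0[OF cd] False Tn cd by blast
      then show ?thesis using g by blast
    qed
    obtain \<alpha> \<beta> where a: "H a = line \<alpha> \<beta>" using ab by (auto simp: L_def)
    obtain \<alpha>1 \<beta>1 where b: "H b = line \<alpha>1 \<beta>1" using ab by (auto simp: L_def)
    obtain g where g: "g \<in> carrier G" "g \<notin> H a" "\<forall>j<n. j \<noteq> a \<longrightarrow> g \<in> H j" "C g = 0"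
      using C_wit[OF ab(1)] by blast
    have "\<not> int p dvd S g" using g(1,2,4) by (auto simp: a line_def)
    moreover have "g \<in> H b" using g ab Ln by metis
    then have "int p dvd \<alpha>1 * S g" using g(4) by (simp add: b line_def)
    ultimately have "int p dvd \<alpha>1" using prime_dvd_mult_iff[OF prime_int_p] by blast
    obtain h where h: "h \<in> carrier G" "h \<notin> H b" "C h = 0"
      using C_wit[OF ab(2)] by blast
    then show False using \<open>int p dvd \<alpha>1\<close> by (simp add: b line_def)
  qed
  \<comment> \<open>Either two points and at most one line, or at most one point and two
    lines.\<close>
  then have "card L + card T \<le> 3" using T2 L2 by (cases "card T \<ge> 2") auto
  then show False using nLT np p_ge_3 by simp
qed

lemma MaxDim: "MaxDim G = p"
  unfolding MaxDim_def
proof (rule Max_eqI)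
  let ?M = "{n. \<exists>H :: nat \<Rightarrow> 'a set. (\<forall>k<n. maximal_subgroup (H k) G) \<and> general_position G {..<n} H}"
  show le: "n \<le> p" if "n \<in> ?M" for n using that general_position_maximal_le by blast
  then have "?M \<subseteq> {..p}" by blast
  then show "finite ?M" using finite_subset by blast
  let ?H = "\<lambda>k::nat. stab (single (int k) 1)"
  have "general_position G {..<p} ?H"
  proof (rule general_positionI)
    fix k assume k: "k \<in> {..<p}"
    show "subgroup (?H k) G" by (simp add: stab_subgroup)
    show "\<exists>g\<in>carrier G. g \<notin> ?H k \<and> (\<forall>j\<in>{..<p}. j \<noteq> k \<longrightarrow> g \<in> ?H j)"
    proof (intro bexI conjI ballI impI)
      \<comment> \<open>The witness scales the k-th coordinate by \<open>chi 1\<close>, so it fixes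
        every unit vector except the k-th.\<close>
      show "dl (int k) \<notin> ?H k"
      proof
        assume "dl (int k) \<in> ?H k"
        then have "[chi 1 * 1 = 1] (mod int q)"
          using k by (simp add: stab_def dl) (metis single_def mult.right_neutral)
        then show False using chi_1 by simp
      qed
      fix j assume j: "j \<in> {..<p}" "j \<noteq> k"
      have "[chi (single (int k) 1 i) * single (int j) 1 i = single (int j) 1 i] (mod int q)" for i
      proof (cases "i mod int p = int j mod int p")
        case True
        then have "single (int k) 1 i = 0" using j k by (auto simp: single_def)
        then show ?thesis by (simp add: cong_def)
      qed (simp add: single_def)
      then show "dl (int k) \<in> ?H j" by (simp add: stab_def dl)
    qed (fact dl)
  qed
  then show "p \<in> ?M" by (intro CollectI exI[of _ ?H]) (simp add: stab_maximal)
qed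

section \<open>Solvability and Fitting length\<close>

lemma VV_subgroup: "subgroup VV G"
  by (rule finite_subgroupI[OF finite_carrier])
    (auto simp: VV_mult(1), auto simp: VV_def A_one C_one)

lemma VV_normal: "VV \<lhd> G"
  by (rule normal_invI[OF VV_subgroup]) (rule VV_conj(1))

lemma VV_commute:
  assumes "x \<in> VV" "y \<in> VV"
  shows "x \<otimes> y = y \<otimes> x"
  using assms by (intro coordinates_inject) (auto simp: VV_def V_mult A_mult C_mult add.commute)

lemma solvable: "solvable G"
proof -
  have 1: "derived G (carrier G) \<subseteq> line 0 1"
    by (intro derived_subset line_subgroup) (simp add: line_0_1 C_commutator)
  have "derived G (line 0 1) \<subseteq> VV"
  proof (intro derived_subset VV_subgroup)
    fix x y assume "x \<in> line 0 1" "y \<in> line 0 1"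
    then have c: "x \<in> carrier G" "y \<in> carrier G" "C x = 0" "C y = 0" by (auto simp: line_0_1)
    then show "x \<otimes> y \<otimes> inv x \<otimes> inv y \<in> VV"
      by (auto simp: VV_def C_commutator A_commutator)
  qed
  then have 2: "derived G (derived G (carrier G)) \<subseteq> VV" using mono_derived[OF 1] by blast
  have "derived G VV \<subseteq> {\<one>}"
  proof (intro derived_subset triv_subgroup)
    fix x y assume xy: "x \<in> VV" "y \<in> VV"
    then have c: "x \<in> carrier G" "y \<in> carrier G" using VV_subset by auto
    show "x \<otimes> y \<otimes> inv x \<otimes> inv y \<in> {\<one>}"
      unfolding commutator_eq[OF c] using VV_commute[OF xy] c by simp
  qed
  then have "derived G (derived G (derived G (carrier G))) \<subseteq> {\<one>}" using mono_derived[OF 2] by blast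
  moreover have "\<one> \<in> derived G (derived G (derived G (carrier G)))"
    unfolding derived_def by (rule generate.one)
  ultimately have "(derived G ^^ 3) (carrier G) = {\<one>}" by (auto simp: numeral_3_eq_3)
  then show ?thesis
    unfolding solvable_def using trivial_derived_seq_imp_solvable subgroup_self by blast
qed

section \<open>The Fitting subgroup\<close>

text \<open>If \<open>x\<close> has trivial shift and acts nontrivially on the \<open>k\<close>-th coordinate of \<open>VV\<close>,
  then no iterated commutator of \<open>ev k\<close> with \<open>x\<close> vanishes.\<close>

lemma nilpotent_normal_shiftless:
  assumes N: "N \<lhd> G" and nil: "nilpotent (G\<lparr>carrier := N\<rparr>)" and x: "x \<in> N" "C x = 0"
  shows "A x k = 0"
proof (rule ccontr)
  assume Ak: "A x k \<noteq> 0"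
  have sub: "subgroup N G" using N by (rule normal_imp_subgroup)
  have xc: "x \<in> carrier G" using subgroup.mem_carrier[OF sub x(1)] .
  have nd: "\<not> int q dvd chi (A x k) - 1"
  proof
    assume "int q dvd chi (A x k) - 1"
    then have "int p dvd A x k" using chi_eq_1_iff by (simp add: cong_iff_dvd_diff)
    then show False using A_mod[OF xc, of k] Ak by simp
  qed
  have "\<exists>w\<in>lower_central_series (G\<lparr>carrier := N\<rparr>) j. w \<in> N \<and> w \<in> VV \<and> V w k \<noteq> 0" for j
  proof (induction j)
    case 0
    let ?e = "ev k"
    \<comment> \<open>The unit vector itself need not lie in \<open>N\<close>, but its commutator
      with \<open>x\<close> does by normality.\<close>
    let ?w = "x \<otimes> ?e \<otimes> inv x \<otimes> inv ?e"
    have "?e \<otimes> inv x \<otimes> inv ?e \<in> N"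
      using normal.inv_op_closed2[OF N ev(1) subgroup.m_inv_closed[OF sub x(1)]] .
    then have "x \<otimes> (?e \<otimes> inv x \<otimes> inv ?e) \<in> N" by (rule subgroup.m_closed[OF sub x(1)])
    moreover have "x \<otimes> (?e \<otimes> inv x \<otimes> inv ?e) = ?w" using xc ev by (simp add: m_assoc)
    ultimately have "?w \<in> N" by simp
    moreover have "?w \<in> VV" using VV_commutator(1)[OF xc ev_VV] .
    moreover have "V ?w k = (chi (A x k) - 1) mod int q"
      using VV_commutator(2)[OF xc ev_VV, of k k] x(2) by (simp add: ev single_def)
    then have "V ?w k \<noteq> 0" using nd by (simp add: dvd_eq_mod_eq_0)
    ultimately show ?case by (intro bexI[of _ ?w]) simp_all
  next
    case (Suc j)
    then obtain w where w: "w \<in> lower_central_series (G\<lparr>carrier := N\<rparr>) j" "w \<in> N" "w \<in> VV" "V w k \<noteq> 0"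
      by blast
    have wc: "w \<in> carrier G" "A w = (\<lambda>i. 0)" "C w = 0" using w(3) by (auto simp: VV_def)
    let ?w = "w \<otimes> x \<otimes> inv w \<otimes> inv x"
    have "?w \<in> lower_central_series (G\<lparr>carrier := N\<rparr>) (Suc j)"
      using w(1,2) x(1) by (auto intro!: generate.incl bexI[of _ w] bexI[of _ x] simp: m_inv_consistent[OF sub])
    moreover have "?w \<in> N"
      using w x by (intro subgroup.m_closed[OF sub] subgroup.m_inv_closed[OF sub])
    moreover have AC: "A (w \<otimes> x) = A (x \<otimes> w)" "C (w \<otimes> x) = C (x \<otimes> w)"
      using wc xc by (auto simp: A_mult C_mult)
    note div = div_in_VV[OF m_closed[OF wc(1) xc] m_closed[OF xc wc(1)] AC]
    have "?w \<in> VV" unfolding commutator_eq[OF wc(1) xc] by (rule div(1))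
    moreover have "V ?w k \<noteq> 0"
    proof
      assume "V ?w k = 0"
      then have "(V (w \<otimes> x) k - V (x \<otimes> w) k) mod int q = 0"
        unfolding commutator_eq[OF wc(1) xc] div(2) .
      \<comment> \<open>Bracketing with \<open>x\<close> multiplies the k-th coordinate by
        \<open>1 - chi (A x k)\<close>, which is invertible modulo q.\<close>
      then have "int q dvd (chi (A x k) - 1) * V w k"
        using xc wc x(2) by (simp add: V_mult mod_simps dvd_eq_mod_eq_0 algebra_simps)
          (metis dvd_eq_mod_eq_0 dvd_diff_commute)
      then have "int q dvd V w k" using nd prime_q prime_dvd_mult_iff[of "int q"] by auto
      then show False using w(4) V_mod[OF wc(1), of k] by simp
    qed
    ultimately show ?case by blast
  qed
  moreover obtain m where "lower_central_series (G\<lparr>carrier := N\<rparr>) m = {\<one>}"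
    using nil by (auto simp: nilpotent_def)
  ultimately show False using V_one by (metis singletonD)
qed

text \<open>If \<open>x\<close> in \<open>N\<close> had a nontrivial shift, its commutator with
  \<open>dl 0\<close> would be a shiftless element of \<open>N\<close> with exponent -1 at
  coordinate 0, contradicting \<open>nilpotent_normal_shiftless\<close>.\<close>

lemma nilpotent_normal_subset_VV:
  assumes N: "N \<lhd> G" and nil: "nilpotent (G\<lparr>carrier := N\<rparr>)"
  shows "N \<subseteq> VV"
proof
  fix x assume x: "x \<in> N"
  have sub: "subgroup N G" using N by (rule normal_imp_subgroup)
  have xc: "x \<in> carrier G" using subgroup.mem_carrier[OF sub x] .
  have "C x = 0"
  proof (rule ccontr)
    assume "C x \<noteq> 0"
    then have "\<not> int p dvd - C x" using C_range[OF xc] not_dvd_small[of "C x" p] by auto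
    let ?d = "dl 0"
    let ?w = "x \<otimes> ?d \<otimes> inv x \<otimes> inv ?d"
    have "?d \<otimes> inv x \<otimes> inv ?d \<in> N"
      using normal.inv_op_closed2[OF N dl(1) subgroup.m_inv_closed[OF sub x]] .
    then have "x \<otimes> (?d \<otimes> inv x \<otimes> inv ?d) \<in> N" by (rule subgroup.m_closed[OF sub x])
    moreover have "x \<otimes> (?d \<otimes> inv x \<otimes> inv ?d) = ?w" using xc dl by (simp add: m_assoc)
    ultimately have w: "?w \<in> N" by simp
    have "single 0 1 (- C x) = 0"
      using \<open>\<not> int p dvd - C x\<close> by (simp add: single_def dvd_eq_mod_eq_0)
    then have "A ?w 0 = (- 1) mod int p"
      using A_commutator[OF xc dl(1)[of 0], of 0] by (simp add: dl single_def)
    moreover have "(- 1) mod int p \<noteq> 0" using p_gt_1 by (simp add: zmod_zminus1_eq_if)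
    moreover have "A ?w 0 = 0"
      using nilpotent_normal_shiftless[OF N nil w C_commutator[OF xc dl(1)]] .
    ultimately show False by simp
  qed
  then have "A x = (\<lambda>i. 0)" using nilpotent_normal_shiftless[OF N nil x] by auto
  then show "x \<in> VV" using xc \<open>C x = 0\<close> by (simp add: VV_def)
qed

lemma fitting_subgroup_eq_VV: "fitting_subgroup G = VV"
proof (rule fitting_subgroupI[OF VV_normal])
  have "comm_group (G\<lparr>carrier := VV\<rparr>)"
    by (rule group.group_comm_groupI[OF subgroup.subgroup_is_group[OF VV_subgroup group]])
      (simp add: VV_commute)
  then show "nilpotent (G\<lparr>carrier := VV\<rparr>)" by (rule comm_group.comm_group_nilpotent)
qed (rule nilpotent_normal_subset_VV)

lemma affine_monomial_trivial_quotient: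
  "affine_monomial (G Mod {\<one>}) p q chi (\<lambda>B. V (the_elem B)) (\<lambda>B. A (the_elem B)) (\<lambda>B. C (the_elem B))"
proof -
  have car: "carrier (G Mod {\<one>}) = (\<lambda>x. {x}) ` carrier G"
    unfolding carrier_FactGroup by (intro image_cong refl) (auto simp: r_coset_def)
  have mul: "{x} <#> {y} = {x \<otimes> y}" for x y by (auto simp: set_mult_def)
  show ?thesis
  proof
    fix v a c assume "periodic p v" "periodic p a"
    then obtain x where "x \<in> carrier G" "V x = (\<lambda>i. v i mod int q)" "A x = (\<lambda>i. a i mod int p)" "C x = c mod int p"
      using coordinates_ex by blast
    then show "\<exists>B\<in>carrier (G Mod {\<one>}). V (the_elem B) = (\<lambda>i. v i mod int q) \<and>
        A (the_elem B) = (\<lambda>i. a i mod int p) \<and> C (the_elem B) = c mod int p"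
      by (intro bexI[of _ "{x}"]) (auto simp: car)
  qed (auto simp: car mul prime_p p_ge_3 prime_q chi_add chi_eq_1_iff V_one A_one C_one
      V_periodic A_periodic V_range A_range C_range V_mult A_mult C_mult intro: coordinates_inject)
qed

lemma fitting_series_1: "fitting_series G (Suc 0) = VV"
proof -
  have F: "fitting_subgroup (G Mod {\<one>}) =
      {B \<in> carrier (G Mod {\<one>}). A (the_elem B) = (\<lambda>i. 0) \<and> C (the_elem B) = 0}"
    using affine_monomial.fitting_subgroup_eq_VV[OF affine_monomial_trivial_quotient]
      affine_monomial.VV_def[OF affine_monomial_trivial_quotient] by simp
  have coset: "{\<one>} #> x = {x}" if "x \<in> carrier G" for x using that by (auto simp: r_coset_def)
  then have "{\<one>} #> x \<in> fitting_subgroup (G Mod {\<one>}) \<longleftrightarrow> x \<in> VV" if "x \<in> carrier G" for x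
    unfolding F using that by (auto simp: carrier_FactGroup VV_def)
  then show ?thesis using VV_subset by auto
qed

text \<open>A central series of G modulo \<open>VV\<close>: term 0 is G, term 1 the shiftless
  elements, and every later term kills one more moment. Hence all p moments vanish at index p +
  1.\<close>

definition moment_filtration :: "nat \<Rightarrow> 'a set" where
  "moment_filtration n = {x \<in> carrier G. n > 0 \<longrightarrow> C x = 0 \<and> (\<forall>l. Suc l < n \<longrightarrow> int p dvd moment p l (A x))}"

lemma moment_filtration_subgroup: "subgroup (moment_filtration n) G"
proof (rule finite_subgroupI[OF finite_carrier])
  show "\<one> \<in> moment_filtration n" by (simp add: moment_filtration_def A_one C_one moment_def)
  fix x y assume x: "x \<in> moment_filtration n" and y: "y \<in> moment_filtration n"
  have c: "x \<in> carrier G" "y \<in> carrier G" using x y by (auto simp: moment_filtration_def)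
  have "int p dvd moment p l (A (x \<otimes> y))" if "n > 0" "Suc l < n" for l
  proof -
    have "C x = 0" using x that by (simp add: moment_filtration_def)
    then have "A (x \<otimes> y) = (\<lambda>i. (A x i + A y i) mod int p)" using c by (auto simp: A_mult)
    moreover have "int p dvd moment p l (\<lambda>i. A x i + A y i)"
      using x y that by (simp add: moment_add moment_filtration_def)
    ultimately show ?thesis using moment_mod[of p l "\<lambda>i. A x i + A y i"] by (simp add: cong_dvd_iff)
  qed
  then show "x \<otimes> y \<in> moment_filtration n"
    using x y c by (auto simp: moment_filtration_def C_mult)
qed (auto simp: moment_filtration_def)

text \<open>For n > 0 the exponent vector of the commutator is \<open>A x\<close> minus a shift of
  it, and a shift preserves the lowest nonvanishing moment modulo p. For n = 0 it is enough that
  commutators are shiftless.\<close>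

lemma moment_filtration_commutator:
  assumes x: "x \<in> moment_filtration n" and y: "y \<in> carrier G"
  shows "x \<otimes> y \<otimes> inv x \<otimes> inv y \<in> moment_filtration (Suc n)"
proof -
  let ?w = "x \<otimes> y \<otimes> inv x \<otimes> inv y"
  have xc: "x \<in> carrier G" using x by (simp add: moment_filtration_def)
  have "int p dvd moment p l (A ?w)" if l: "l < n" for l
  proof -
    have C: "C x = 0" and m: "\<And>j. Suc j < n \<Longrightarrow> int p dvd moment p j (A x)"
      using x l by (auto simp: moment_filtration_def)
    have "A ?w = (\<lambda>i. (A x i - A x (i - C y)) mod int p)"
      using A_commutator[OF xc y] C by auto
    then have w: "[moment p l (A ?w) = moment p l (A x) - moment p l (\<lambda>i. A x (i - C y))] (mod int p)"
      using moment_mod[of p l "\<lambda>i. A x i - A x (i - C y)"] by (simp add: moment_diff)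
    have "[moment p l (\<lambda>i. A x (i - C y)) = moment p l (A x)] (mod int p)"
      using moment_shift_lowest(1)[OF A_periodic[OF xc] p_pos, of l "C y"] m l by auto
    then have "int p dvd moment p l (A x) - moment p l (\<lambda>i. A x (i - C y))"
      by (simp add: cong_iff_dvd_diff dvd_diff_commute)
    then show ?thesis using w cong_dvd_iff by blast
  qed
  then show ?thesis using xc y C_commutator[OF xc y] by (simp add: moment_filtration_def)
qed

lemma moment_filtration_last: "moment_filtration (Suc p) = VV"
proof (intro equalityI subsetI)
  fix x assume x: "x \<in> moment_filtration (Suc p)"
  then have xc: "x \<in> carrier G" and "C x = 0" by (auto simp: moment_filtration_def)
  have "A x i = 0" for i
    using moments_zero_imp[OF A_periodic[OF xc] prime_p, of i] x A_mod[OF xc, of i]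
    by (simp add: moment_filtration_def)
  then show "x \<in> VV" using xc \<open>C x = 0\<close> by (auto simp: VV_def)
qed (auto simp: VV_def moment_filtration_def moment_def)

lemma quotient_nilpotent: "nilpotent (G Mod VV)"
proof -
  interpret Q: group "G Mod VV" using VV_normal normal.factorgroup_is_group by blast
  interpret pr: group_hom G "G Mod VV" "\<lambda>x. VV #> x"
    by unfold_locales (rule normal.r_coset_hom_Mod[OF VV_normal])
  show ?thesis
  proof (rule Q.nilpotentI[where \<Gamma>="\<lambda>n. (\<lambda>x. VV #> x) ` moment_filtration n" and m="Suc p"])
    show "subgroup ((\<lambda>x. VV #> x) ` moment_filtration n) (G Mod VV)" for n
      by (rule pr.subgroup_img_is_subgroup[OF moment_filtration_subgroup])
    show "(\<lambda>x. VV #> x) ` moment_filtration 0 = carrier (G Mod VV)"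
      by (simp add: carrier_FactGroup moment_filtration_def)
    have "(\<lambda>x. VV #> x) ` VV = {VV}"
      using coset_join2[OF _ VV_subgroup] VV_subset subgroup.one_closed[OF VV_subgroup] by force
    then show "(\<lambda>x. VV #> x) ` moment_filtration (Suc p) = {\<one>\<^bsub>G Mod VV\<^esub>}"
      by (simp add: moment_filtration_last)
    fix n B Y assume "B \<in> (\<lambda>x. VV #> x) ` moment_filtration n" "Y \<in> carrier (G Mod VV)"
    then obtain x y where x: "x \<in> moment_filtration n" "B = VV #> x" and y: "y \<in> carrier G" "Y = VV #> y"
      by (auto simp: carrier_FactGroup)
    have xc: "x \<in> carrier G" using x by (simp add: moment_filtration_def)
    have "B \<otimes>\<^bsub>G Mod VV\<^esub> Y \<otimes>\<^bsub>G Mod VV\<^esub> inv\<^bsub>G Mod VV\<^esub> B \<otimes>\<^bsub>G Mod VV\<^esub> inv\<^bsub>G Mod VV\<^esub> Y =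
        VV #> (x \<otimes> y \<otimes> inv x \<otimes> inv y)"
      unfolding x(2) y(2) using xc y(1) by (simp only: pr.hom_mult pr.hom_inv m_closed inv_closed)
    then show "B \<otimes>\<^bsub>G Mod VV\<^esub> Y \<otimes>\<^bsub>G Mod VV\<^esub> inv\<^bsub>G Mod VV\<^esub> B \<otimes>\<^bsub>G Mod VV\<^esub> inv\<^bsub>G Mod VV\<^esub> Y
        \<in> (\<lambda>x. VV #> x) ` moment_filtration (Suc n)"
      using moment_filtration_commutator[OF x(1) y(1)] by simp
  qed
qed

lemma fitting_length: "fitting_length G = 2"
  unfolding fitting_length_def
proof (rule Least_equality)
  have "group (G Mod VV)" using VV_normal normal.factorgroup_is_group by blast
  then have "fitting_subgroup (G Mod VV) = carrier (G Mod VV)"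
    using group.fitting_subgroup_nilpotent quotient_nilpotent by blast
  then have "fitting_series G (Suc (Suc 0)) = carrier G"
    using fitting_series_1 by (subst fitting_series.simps) (auto simp: carrier_FactGroup)
  then show "fitting_series G 2 = carrier G" by (simp only: numeral_2_eq_2)
  have "sh \<notin> VV" by (simp add: VV_def sh)
  then have "VV \<noteq> carrier G" using sh(1) by blast
  moreover have "{\<one>} \<noteq> carrier G" using ev_neq_one ev(1)[of 0] by (metis singletonD)
  ultimately have ne: "fitting_series G n \<noteq> carrier G" if "n < 2" for n
    using that fitting_series_1 by (auto simp: less_Suc_eq numeral_2_eq_2)
  show "2 \<le> n" if "fitting_series G n = carrier G" for n
    using ne[of n] that by linarith
qed

end

section \<open>Existence\<close>

lemma exists_faithful_character:
  assumes p: "Factorial_Ring.prime p"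
  obtains q :: nat and chi :: "int \<Rightarrow> int" where "Factorial_Ring.prime q"
    "\<And>s t. [chi (s + t) = chi s * chi t] (mod int q)"
    "\<And>s. [chi s = 1] (mod int q) \<longleftrightarrow> int p dvd s"
proof -
  have p1: "p > 1" using p prime_gt_1_nat by blast
  have "(2::nat) ^ 2 \<le> 2 ^ p" using p1 by (intro power_increasing) auto
  then have "(2::nat) ^ p - 1 \<noteq> 1" by simp
  then obtain q :: nat where q: "Factorial_Ring.prime q" "q dvd 2 ^ p - 1" using prime_factor_nat by blast
  have pow1: "[2 ^ p = 1] (mod q)" using q(2) by (simp add: cong_altdef_nat)
  then have "ord q 2 dvd p" using ord_divides by blast
  moreover have "ord q 2 \<noteq> 1"
  proof
    assume "ord q 2 = 1"
    then have "[2 = 1] (mod q)" using ord_eq_Suc_0_iff[of q 2] by simp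
    then have "q dvd 1" by (simp add: cong_altdef_nat)
    then show False using q(1) by simp
  qed
  ultimately have ord: "ord q 2 = p" using p by (metis prime_nat_iff)
  then have cop: "coprime q 2" using p1 ord_eq_0 by (metis not_one_less_zero)
  \<comment> \<open>The exponent is reduced because \<open>chi\<close> must be defined at negative
    integers too.\<close>
  define chi where "chi s = int (2 ^ nat (s mod int p))" for s
  have pow_cong: "[int (2 ^ m) = int (2 ^ n)] (mod int q) \<longleftrightarrow> [int m = int n] (mod int p)" for m n
    unfolding cong_int_iff using order_divides_expdiff[OF cop, of m n] ord by simp
  have add: "[chi (s + t) = chi s * chi t] (mod int q)" for s t
  proof -
    have "chi s * chi t = int (2 ^ (nat (s mod int p) + nat (t mod int p)))"
      by (simp add: chi_def power_add)
    moreover have "[int (nat ((s + t) mod int p)) = int (nat (s mod int p) + nat (t mod int p))] (mod int p)"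
      using p1 by (simp add: cong_def mod_simps)
    ultimately show ?thesis using pow_cong by (simp only: chi_def)
  qed
  have faithful: "[chi s = 1] (mod int q) \<longleftrightarrow> int p dvd s" for s
  proof -
    have "[chi s = 1] (mod int q) \<longleftrightarrow> [int (nat (s mod int p)) = int 0] (mod int p)"
      using pow_cong[of "nat (s mod int p)" 0] by (simp only: chi_def power_0 of_nat_1)
    also have "\<dots> \<longleftrightarrow> int p dvd s" using p1 by (simp add: cong_0_iff dvd_mod_iff)
    finally show ?thesis .
  qed
  show ?thesis by (rule that[OF q(1) add faithful])
qed

text \<open>The coordinate triples form a finite set. An arbitrary injection \<open>f\<close>
  carries it to the natural numbers, as the carrier must have that type, and \<open>D\<close>
  decodes.\<close>

lemma exists_affine_monomial:
  assumes p: "Factorial_Ring.prime p" "p \<ge> 3"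
  obtains G :: "nat monoid" and q chi V A C where "affine_monomial G p q chi V A C"
proof -
  obtain q :: nat and chi :: "int \<Rightarrow> int" where q: "Factorial_Ring.prime q"
    and chi: "\<And>s t. [chi (s + t) = chi s * chi t] (mod int q)"
      "\<And>s. [chi s = 1] (mod int q) \<longleftrightarrow> int p dvd s"
    using exists_faithful_character[OF p(1)] by blast
  have p0: "p > 0" and q0: "q > 0" using p q prime_gt_0_nat by auto
  let ?R = "\<lambda>n. {f. periodic p f \<and> (\<forall>i. 0 \<le> f i \<and> f i < int n)}"
  let ?T = "?R q \<times> ?R p \<times> {0..<int p}"
  have "finite ?T" by (intro finite_cartesian_product card_reduced_periodic p0) auto
  then obtain f :: "_ \<Rightarrow> nat" where f: "inj_on f ?T" using finite_imp_inj_to_nat_seg by blast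
  define D where "D = the_inv_into ?T f"
  have D: "D (f (v, a, c)) = (v, a, c)" if "(v, a, c) \<in> ?T" for v a c
    using the_inv_into_f_f[OF f that] by (simp add: D_def)
  \<comment> \<open>The triple (v, a, c) stands for the affine map that sends t to v plus
    \<open>chi\<close> of a times t shifted by c; the product is the composition.\<close>
  define mul where "mul = (\<lambda>(v, a, c) (w, b, d).
     (\<lambda>i::int. (v i + chi (a i) * w (i - c)) mod int q, \<lambda>i::int. (a i + b (i - c)) mod int p, (c + d) mod int p))"
  define G where "G = \<lparr>carrier = f ` ?T, monoid.mult = \<lambda>x y. f (mul (D x) (D y)), one = f (\<lambda>i. 0, \<lambda>i. 0, 0)\<rparr>"
  have mulT: "mul (v, a, c) (w, b, d) \<in> ?T" if "(v, a, c) \<in> ?T" "(w, b, d) \<in> ?T" for v a c w b d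
  proof -
    have "periodic p v" "periodic p a" "periodic p (\<lambda>i. w (i - c))" "periodic p (\<lambda>i. b (i - c))"
      using that periodic_shift by auto
    then show ?thesis using p0 q0 by (simp add: mul_def periodic_def)
  qed
  have oneT: "(\<lambda>i. 0, \<lambda>i. 0, 0) \<in> ?T" using p0 q0 by (simp add: periodic_def)
  let ?V = "\<lambda>x. fst (D x)" and ?A = "\<lambda>x. fst (snd (D x))" and ?C = "\<lambda>x. snd (snd (D x))"
  have car: "\<exists>v a c. (v, a, c) \<in> ?T \<and> x = f (v, a, c)" if "x \<in> carrier G" for x
  proof -
    obtain t where "t \<in> ?T" "x = f t" using \<open>x \<in> carrier G\<close> by (auto simp: G_def)
    then show ?thesis by (cases t) blast
  qed
  have mult: "x \<otimes>\<^bsub>G\<^esub> y \<in> carrier G \<and> D (x \<otimes>\<^bsub>G\<^esub> y) = mul (D x) (D y)"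
    if x: "x \<in> carrier G" and y: "y \<in> carrier G" for x y
  proof -
    obtain v a c where 1: "(v, a, c) \<in> ?T" "x = f (v, a, c)" using car[OF x] by blast
    obtain w b d where 2: "(w, b, d) \<in> ?T" "y = f (w, b, d)" using car[OF y] by blast
    have m: "mul (v, a, c) (w, b, d) \<in> ?T" using mulT[OF 1(1) 2(1)] .
    have "D (f (mul (v, a, c) (w, b, d))) = mul (v, a, c) (w, b, d)"
      unfolding D_def by (rule the_inv_into_f_f[OF f m])
    then show ?thesis
      using m D[OF 1(1)] D[OF 2(1)] unfolding 1(2) 2(2) by (simp add: G_def)
  qed
  have "affine_monomial G p q chi ?V ?A ?C"
  proof (unfold_locales)
    fix x y assume x: "x \<in> carrier G" and y: "y \<in> carrier G"
    show "x \<otimes>\<^bsub>G\<^esub> y \<in> carrier G" using mult[OF x y] by blast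
    show "?V (x \<otimes>\<^bsub>G\<^esub> y) i = (?V x i + chi (?A x i) * ?V y (i - ?C x)) mod int q" for i
      using mult[OF x y] by (simp add: mul_def case_prod_beta)
    show "?A (x \<otimes>\<^bsub>G\<^esub> y) i = (?A x i + ?A y (i - ?C x)) mod int p" for i
      using mult[OF x y] by (simp add: mul_def case_prod_beta)
    show "?C (x \<otimes>\<^bsub>G\<^esub> y) = (?C x + ?C y) mod int p"
      using mult[OF x y] by (simp add: mul_def case_prod_beta)
    assume "?V x = ?V y" "?A x = ?A y" "?C x = ?C y"
    then have "D x = D y" by (simp add: prod_eq_iff)
    moreover have "f (D x) = x" "f (D y) = y"
      using x y f_the_inv_into_f[OF f] by (simp_all add: G_def D_def)
    ultimately show "x = y" by metis
  next
    fix v a c assume va: "periodic p v" "periodic p a"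
    let ?t = "(\<lambda>i. v i mod int q, \<lambda>i. a i mod int p, c mod int p)"
    have t: "?t \<in> ?T" using va p0 q0 by (simp add: periodic_def)
    show "\<exists>x\<in>carrier G. ?V x = (\<lambda>i. v i mod int q) \<and> ?A x = (\<lambda>i. a i mod int p) \<and> ?C x = c mod int p"
    proof (intro bexI)
      show "?V (f ?t) = (\<lambda>i. v i mod int q) \<and> ?A (f ?t) = (\<lambda>i. a i mod int p) \<and> ?C (f ?t) = c mod int p"
        using D[OF t] by simp
      show "f ?t \<in> carrier G" using t by (simp add: G_def)
    qed
  next
    fix x assume "x \<in> carrier G"
    then obtain v a c where x: "(v, a, c) \<in> ?T" "x = f (v, a, c)" using car by blast
    note Dx = D[OF x(1)]
    show "periodic p (?V x)" "periodic p (?A x)" "0 \<le> ?C x \<and> ?C x < int p"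
      using x Dx by auto
    show "0 \<le> ?V x i \<and> ?V x i < int q" "0 \<le> ?A x i \<and> ?A x i < int p" for i
      using x Dx by auto
  qed (use p q chi D[OF oneT] oneT in \<open>simp_all add: G_def\<close>)
  then show ?thesis using that by blast
qed

theorem theorem2:
  fixes p :: nat
  assumes "Factorial_Ring.prime p" and "odd p"
  shows "\<exists>G :: nat monoid.
           group G \<and> finite (carrier G) \<and> solvable G \<and> fitting_length G = 2 \<and>
           max_irredundant_generating G = 3 \<and> MaxDim G = p \<and> max_irredundant G = 2 * p"
proof -
  have "p \<noteq> 2" using assms(2) by auto
  then have "p \<ge> 3" using prime_ge_2_nat[OF assms(1)] by simp
  then obtain G :: "nat monoid" and q chi V A C where "affine_monomial G p q chi V A C"
    using exists_affine_monomial[OF assms(1)] by blast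
  then interpret affine_monomial G p q chi V A C .
  show ?thesis
    using group finite_carrier solvable fitting_length max_irredundant_generating MaxDim max_irredundant
    by blast
qed

end
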